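(* Let $I$ be a set and let $\mathcal{C}$ be an $\mathbf{AMon}$ category with a zero object in which every family $(X_i)_{i\in I}$ of objects indexed by $I$ has a product $\prod_{i\in I}X_i$ and a coproduct $\bigoplus_{i\in I}X_i$. Suppose that $\mathcal{C}$ has at least one nonzero morphism $f:X\to Y$ that is invertible in the abelian monoid $\mathrm{Hom}(X,Y)$. Then the functors $\bigoplus_{i\in I}:\mathcal{C}^I\to\mathcal{C}$ and $\prod_{i\in I}:\mathcal{C}^I\to\mathcal{C}$ are isomorphic (i.e. naturally isomorphic) if and only if $I$ is finite.
   Context: An $\mathbf{AMon}$ category is a category in which, for any objects $X,Y$, the set $\mathrm{Hom}(X,Y)$ carries the structure of an abelian monoid (written additively) compatible with composition, i.e. composition is additive in each variable and sends the neutral element to the neutral element in each variable. A zero object is an object that is both initial and terminal. For objects $A,B$ the zero morphism $0_{A,B}\in\mathrm{Hom}(A,B)$ is the composite $A\to 0\to B$; it is the neutral element of $\mathrm{Hom}(A,B)$. A morphism $f:X\to Y$ is invertible in the monoid $\mathrm{Hom}(X,Y)$ if there is $g\in\mathrm{Hom}(X,Y)$ with $f+g=0_{X,Y}$. $\mathcal{C}^I$ is the product category of $I$-indexed families of objects; $\bigoplus_{i\in I}$ and $\prod_{i\in I}$ are the left and right adjoints of the diagonal functor $\Delta:\mathcal{C}\to\mathcal{C}^I$, $X\mapsto (X)_{i\in I}$. *)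

theory Defs
  imports "HOL-Algebra.Group"
begin

section \<open>Categories\<close>

text \<open>\<open>Comp C g f\<close> is the composite of \<open>f\<close> followed by \<open>g\<close>; it is
  only meaningful when \<open>Cod C f = Dom C g\<close>.\<close>

record ('o, 'a) cat =
  Obj :: "'o set"
  Arr :: "'a set"
  Dom :: "'a \<Rightarrow> 'o"
  Cod :: "'a \<Rightarrow> 'o"
  Ident :: "'o \<Rightarrow> 'a"
  Comp :: "'a \<Rightarrow> 'a \<Rightarrow> 'a"

definition Hom :: "('o, 'a, 'm) cat_scheme \<Rightarrow> 'o \<Rightarrow> 'o \<Rightarrow> 'a set" where
  "Hom C A B = {f \<in> Arr C. Dom C f = A \<and> Cod C f = B}"

locale category =
  fixes C :: "('o, 'a, 'm) cat_scheme"
  assumes dom_in: "f \<in> Arr C \<Longrightarrow> Dom C f \<in> Obj C"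
    and cod_in: "f \<in> Arr C \<Longrightarrow> Cod C f \<in> Obj C"
    and ident_in: "A \<in> Obj C \<Longrightarrow> Ident C A \<in> Hom C A A"
    and comp_in: "f \<in> Hom C A B \<Longrightarrow> g \<in> Hom C B D \<Longrightarrow> Comp C g f \<in> Hom C A D"
    and comp_ident_right: "f \<in> Hom C A B \<Longrightarrow> Comp C f (Ident C A) = f"
    and comp_ident_left: "f \<in> Hom C A B \<Longrightarrow> Comp C (Ident C B) f = f"
    and comp_assoc: "f \<in> Hom C A B \<Longrightarrow> g \<in> Hom C B D \<Longrightarrow> h \<in> Hom C D E \<Longrightarrow>
           Comp C h (Comp C g f) = Comp C (Comp C h g) f"

definition iso_arr :: "('o, 'a, 'm) cat_scheme \<Rightarrow> 'o \<Rightarrow> 'o \<Rightarrow> 'a \<Rightarrow> bool" where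
  "iso_arr C A B f \<longleftrightarrow> f \<in> Hom C A B \<and>
     (\<exists>g \<in> Hom C B A. Comp C g f = Ident C A \<and> Comp C f g = Ident C B)"

definition initial_object :: "('o, 'a, 'm) cat_scheme \<Rightarrow> 'o \<Rightarrow> bool" where
  "initial_object C Z \<longleftrightarrow> Z \<in> Obj C \<and> (\<forall>A \<in> Obj C. \<exists>!f. f \<in> Hom C Z A)"

definition terminal_object :: "('o, 'a, 'm) cat_scheme \<Rightarrow> 'o \<Rightarrow> bool" where
  "terminal_object C Z \<longleftrightarrow> Z \<in> Obj C \<and> (\<forall>A \<in> Obj C. \<exists>!f. f \<in> Hom C A Z)"

definition zero_object :: "('o, 'a, 'm) cat_scheme \<Rightarrow> 'o \<Rightarrow> bool" where
  "zero_object C Z \<longleftrightarrow> initial_object C Z \<and> terminal_object C Z"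

text \<open>The composite does not depend on the zero object chosen; see
  \<open>zero_mor_eq_neutral\<close> below for the case that is used.\<close>

definition zero_mor :: "('o, 'a, 'm) cat_scheme \<Rightarrow> 'o \<Rightarrow> 'o \<Rightarrow> 'a" where
  "zero_mor C A B = (THE h. \<exists>Z u v. zero_object C Z \<and> u \<in> Hom C A Z \<and> v \<in> Hom C Z B \<and>
     h = Comp C v u)"

definition is_product ::
  "('o, 'a, 'm) cat_scheme \<Rightarrow> 'i set \<Rightarrow> ('i \<Rightarrow> 'o) \<Rightarrow> 'o \<Rightarrow> ('i \<Rightarrow> 'a) \<Rightarrow> bool" where
  "is_product C I X P p \<longleftrightarrow> P \<in> Obj C \<and> (\<forall>i\<in>I. p i \<in> Hom C P (X i)) \<and>
     (\<forall>Q \<in> Obj C. \<forall>q. (\<forall>i\<in>I. q i \<in> Hom C Q (X i)) \<longrightarrow>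
        (\<exists>!h. h \<in> Hom C Q P \<and> (\<forall>i\<in>I. Comp C (p i) h = q i)))"

definition is_coproduct ::
  "('o, 'a, 'm) cat_scheme \<Rightarrow> 'i set \<Rightarrow> ('i \<Rightarrow> 'o) \<Rightarrow> 'o \<Rightarrow> ('i \<Rightarrow> 'a) \<Rightarrow> bool" where
  "is_coproduct C I X S s \<longleftrightarrow> S \<in> Obj C \<and> (\<forall>i\<in>I. s i \<in> Hom C (X i) S) \<and>
     (\<forall>Q \<in> Obj C. \<forall>q. (\<forall>i\<in>I. q i \<in> Hom C (X i) Q) \<longrightarrow>
        (\<exists>!h. h \<in> Hom C S Q \<and> (\<forall>i\<in>I. Comp C h (s i) = q i)))"

definition has_products :: "('o, 'a, 'm) cat_scheme \<Rightarrow> 'i set \<Rightarrow> bool" where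
  "has_products C I \<longleftrightarrow> (\<forall>X. (\<forall>i\<in>I. X i \<in> Obj C) \<longrightarrow> (\<exists>P p. is_product C I X P p))"

definition has_coproducts :: "('o, 'a, 'm) cat_scheme \<Rightarrow> 'i set \<Rightarrow> bool" where
  "has_coproducts C I \<longleftrightarrow> (\<forall>X. (\<forall>i\<in>I. X i \<in> Obj C) \<longrightarrow> (\<exists>S s. is_coproduct C I X S s))"


section \<open>Functors, natural isomorphisms, adjunctions\<close>

record ('o1, 'a1, 'o2, 'a2) fctr =
  FObj :: "'o1 \<Rightarrow> 'o2"
  FArr :: "'a1 \<Rightarrow> 'a2"

definition is_functor ::
  "('o1, 'a1, 'm) cat_scheme \<Rightarrow> ('o2, 'a2, 'n) cat_scheme \<Rightarrow> ('o1, 'a1, 'o2, 'a2) fctr \<Rightarrow> bool"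
  where
  "is_functor C D F \<longleftrightarrow>
     (\<forall>A \<in> Obj C. FObj F A \<in> Obj D) \<and>
     (\<forall>A \<in> Obj C. \<forall>B \<in> Obj C. \<forall>f \<in> Hom C A B. FArr F f \<in> Hom D (FObj F A) (FObj F B)) \<and>
     (\<forall>A \<in> Obj C. FArr F (Ident C A) = Ident D (FObj F A)) \<and>
     (\<forall>A \<in> Obj C. \<forall>B \<in> Obj C. \<forall>E \<in> Obj C. \<forall>f \<in> Hom C A B. \<forall>g \<in> Hom C B E.
        FArr F (Comp C g f) = Comp D (FArr F g) (FArr F f))"

definition natural_iso ::
  "('o1, 'a1, 'm) cat_scheme \<Rightarrow> ('o2, 'a2, 'n) cat_scheme \<Rightarrow>
   ('o1, 'a1, 'o2, 'a2) fctr \<Rightarrow> ('o1, 'a1, 'o2, 'a2) fctr \<Rightarrow> ('o1 \<Rightarrow> 'a2) \<Rightarrow> bool" where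
  "natural_iso C D F G \<tau> \<longleftrightarrow>
     (\<forall>A \<in> Obj C. iso_arr D (FObj F A) (FObj G A) (\<tau> A)) \<and>
     (\<forall>A \<in> Obj C. \<forall>B \<in> Obj C. \<forall>f \<in> Hom C A B.
        Comp D (\<tau> B) (FArr F f) = Comp D (FArr G f) (\<tau> A))"

definition naturally_isomorphic ::
  "('o1, 'a1, 'm) cat_scheme \<Rightarrow> ('o2, 'a2, 'n) cat_scheme \<Rightarrow>
   ('o1, 'a1, 'o2, 'a2) fctr \<Rightarrow> ('o1, 'a1, 'o2, 'a2) fctr \<Rightarrow> bool" where
  "naturally_isomorphic C D F G \<longleftrightarrow> (\<exists>\<tau>. natural_iso C D F G \<tau>)"

text \<open>\<open>adjoint C D F G\<close>: \<open>F\<close> from \<open>C\<close> to \<open>D\<close> is left adjoint to \<open>G\<close> from \<open>D\<close> to \<open>C\<close>,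
  i.e. there are bijections between \<open>Hom D (F X) Y\<close> and \<open>Hom C X (G Y)\<close> natural in
  both variables.\<close>

definition adjoint ::
  "('o1, 'a1, 'm) cat_scheme \<Rightarrow> ('o2, 'a2, 'n) cat_scheme \<Rightarrow>
   ('o1, 'a1, 'o2, 'a2) fctr \<Rightarrow> ('o2, 'a2, 'o1, 'a1) fctr \<Rightarrow> bool" where
  "adjoint C D F G \<longleftrightarrow> is_functor C D F \<and> is_functor D C G \<and>
     (\<exists>\<phi> :: 'o1 \<Rightarrow> 'o2 \<Rightarrow> 'a2 \<Rightarrow> 'a1.
        (\<forall>X \<in> Obj C. \<forall>Y \<in> Obj D.
           bij_betw (\<phi> X Y) (Hom D (FObj F X) Y) (Hom C X (FObj G Y))) \<and>
        (\<forall>X \<in> Obj C. \<forall>X' \<in> Obj C. \<forall>Y \<in> Obj D. \<forall>Y' \<in> Obj D.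
           \<forall>u \<in> Hom C X' X. \<forall>v \<in> Hom D Y Y'. \<forall>f \<in> Hom D (FObj F X) Y.
             \<phi> X' Y' (Comp D v (Comp D f (FArr F u))) =
             Comp C (FArr G v) (Comp C (\<phi> X Y f) u)))"


section \<open>The category of families and the diagonal functor\<close>

text \<open>Families indexed by \<open>I\<close> are functions that are \<open>undefined\<close> off \<open>I\<close>, so that
  equality of families is equality on \<open>I\<close>.\<close>

definition power_cat :: "('o, 'a, 'm) cat_scheme \<Rightarrow> 'i set \<Rightarrow> ('i \<Rightarrow> 'o, 'i \<Rightarrow> 'a) cat" where
  "power_cat C I =
     \<lparr> Obj = (\<Pi>\<^sub>E i\<in>I. Obj C),
       Arr = (\<Pi>\<^sub>E i\<in>I. Arr C),
       Dom = (\<lambda>f. \<lambda>i\<in>I. Dom C (f i)),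
       Cod = (\<lambda>f. \<lambda>i\<in>I. Cod C (f i)),
       Ident = (\<lambda>X. \<lambda>i\<in>I. Ident C (X i)),
       Comp = (\<lambda>g f. \<lambda>i\<in>I. Comp C (g i) (f i)) \<rparr>"

definition diag :: "('o, 'a, 'm) cat_scheme \<Rightarrow> 'i set \<Rightarrow> ('o, 'a, 'i \<Rightarrow> 'o, 'i \<Rightarrow> 'a) fctr" where
  "diag C I = \<lparr> FObj = (\<lambda>X. \<lambda>i\<in>I. X), FArr = (\<lambda>f. \<lambda>i\<in>I. f) \<rparr>"

definition is_coproduct_functor ::
  "('o, 'a, 'm) cat_scheme \<Rightarrow> 'i set \<Rightarrow> ('i \<Rightarrow> 'o, 'i \<Rightarrow> 'a, 'o, 'a) fctr \<Rightarrow> bool" where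
  "is_coproduct_functor C I S \<longleftrightarrow> adjoint (power_cat C I) C S (diag C I)"

definition is_product_functor ::
  "('o, 'a, 'm) cat_scheme \<Rightarrow> 'i set \<Rightarrow> ('i \<Rightarrow> 'o, 'i \<Rightarrow> 'a, 'o, 'a) fctr \<Rightarrow> bool" where
  "is_product_functor C I P \<longleftrightarrow> adjoint C (power_cat C I) (diag C I) P"


lemma Obj_power_cat: "X \<in> Obj (power_cat C I) \<longleftrightarrow> X \<in> (\<Pi>\<^sub>E i\<in>I. Obj C)"
  by (simp add: power_cat_def)

lemma Hom_power_cat:
  assumes "X \<in> Obj (power_cat C I)" "Y \<in> Obj (power_cat C I)"
  shows "Hom (power_cat C I) X Y = (\<Pi>\<^sub>E i\<in>I. Hom C (X i) (Y i))"
  using assms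
  by (auto simp: Hom_def power_cat_def PiE_iff extensional_def restrict_def fun_eq_iff)

lemma (in category) Hom_obj:
  assumes "f \<in> Hom C A B"
  shows "A \<in> Obj C" "B \<in> Obj C"
  using assms dom_in cod_in by (auto simp: Hom_def)

lemma (in category) category_power_cat: "category (power_cat C I)"
proof -
  let ?D = "power_cat C I"
  have obj: "X \<in> Obj ?D" "Y \<in> Obj ?D" if "f \<in> Hom ?D X Y" for f X Y
    using that dom_in cod_in
    by (auto simp: Hom_def power_cat_def PiE_iff)
  have hom: "i \<in> I \<Longrightarrow> f i \<in> Hom C (X i) (Y i)" "f \<in> extensional I" if "f \<in> Hom ?D X Y" for f X Y i
    using that Hom_power_cat[OF obj[OF that]] by (auto simp: PiE_iff)
  have comp: "Comp ?D g f = (\<lambda>i\<in>I. Comp C (g i) (f i))" for f g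
    by (simp add: power_cat_def)
  have ident: "Ident ?D X = (\<lambda>i\<in>I. Ident C (X i))" for X
    by (simp add: power_cat_def)
  show ?thesis
  proof
    fix f assume "f \<in> Arr ?D"
    then show "Dom ?D f \<in> Obj ?D" "Cod ?D f \<in> Obj ?D"
      using dom_in cod_in by (auto simp: power_cat_def PiE_iff)
  next
    fix X assume "X \<in> Obj ?D"
    then show "Ident ?D X \<in> Hom ?D X X"
      using ident_in by (auto simp: Hom_power_cat ident Obj_power_cat PiE_iff)
  next
    fix f g X Y Z assume f: "f \<in> Hom ?D X Y" and g: "g \<in> Hom ?D Y Z"
    show "Comp ?D g f \<in> Hom ?D X Z"
      unfolding Hom_power_cat[OF obj(1)[OF f] obj(2)[OF g]] comp
      using hom(1)[OF f] hom(1)[OF g] comp_in by fastforce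
  next
    fix f X Y assume f: "f \<in> Hom ?D X Y"
    show "Comp ?D f (Ident ?D X) = f" "Comp ?D (Ident ?D Y) f = f"
      using hom(2)[OF f] comp_ident_left[OF hom(1)[OF f]] comp_ident_right[OF hom(1)[OF f]]
      by (auto simp: comp ident extensional_def fun_eq_iff)
  next
    fix f g h X Y Z W assume f: "f \<in> Hom ?D X Y" and g: "g \<in> Hom ?D Y Z" and h: "h \<in> Hom ?D Z W"
    show "Comp ?D h (Comp ?D g f) = Comp ?D (Comp ?D h g) f"
      using hom(1)[OF f] hom(1)[OF g] hom(1)[OF h] comp_assoc
      by (fastforce simp: comp fun_eq_iff)
  qed
qed

lemma is_functor_diag:
  assumes "category C"
  shows "is_functor C (power_cat C I) (diag C I)"
proof -
  have o: "(\<lambda>i\<in>I. A) \<in> Obj (power_cat C I)" if "A \<in> Obj C" for A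
    using that by (simp add: Obj_power_cat)
  show ?thesis
    unfolding is_functor_def
    by (auto simp: diag_def o Hom_power_cat) (auto simp: power_cat_def fun_eq_iff)
qed

text \<open>The coproduct and product functors are characterised by an adjunction. They exist as soon as
  products, respectively coproducts, of all \<open>I\<close>-indexed families do.\<close>

lemma (in category) product_functor_exists:
  assumes "has_products C I"
  shows "\<exists>P. is_product_functor C I P"
proof -
  let ?D = "power_cat C I"
  have objD: "X i \<in> Obj C" if "X \<in> Obj ?D" "i \<in> I" for X i
    using that by (auto simp: Obj_power_cat)
  obtain Pr pr where prod: "\<And>X. X \<in> Obj ?D \<Longrightarrow> is_product C I X (Pr X) (pr X)"
    using assms objD unfolding has_products_def by metis
  have Pr: "Pr X \<in> Obj C" if "X \<in> Obj ?D" for X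
    using prod[OF that] by (simp add: is_product_def)
  have pr: "pr X i \<in> Hom C (Pr X) (X i)" if "X \<in> Obj ?D" "i \<in> I" for X i
    using prod[OF that(1)] that(2) by (simp add: is_product_def)
  define tup where "tup X Q q = (THE h. h \<in> Hom C Q (Pr X) \<and> (\<forall>i\<in>I. Comp C (pr X i) h = q i))"
    for X Q q
  have ex1: "\<exists>!h. h \<in> Hom C Q (Pr X) \<and> (\<forall>i\<in>I. Comp C (pr X i) h = q i)"
    if "X \<in> Obj ?D" "Q \<in> Obj C" "\<And>i. i \<in> I \<Longrightarrow> q i \<in> Hom C Q (X i)" for X Q q
    using prod[OF that(1)] that(2,3) unfolding is_product_def by blast
  have tup: "tup X Q q \<in> Hom C Q (Pr X)" "i \<in> I \<Longrightarrow> Comp C (pr X i) (tup X Q q) = q i"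
    if "X \<in> Obj ?D" "Q \<in> Obj C" "\<And>i. i \<in> I \<Longrightarrow> q i \<in> Hom C Q (X i)" for X Q q i
    using theI'[OF ex1[OF that]] unfolding tup_def by auto
  have uniq: "h = h'"
    if "X \<in> Obj ?D" "h \<in> Hom C Q (Pr X)" "h' \<in> Hom C Q (Pr X)"
      "\<And>i. i \<in> I \<Longrightarrow> Comp C (pr X i) h = Comp C (pr X i) h'" for X Q h h'
    using ex1[OF that(1) Hom_obj(1)[OF that(2)], of "\<lambda>i. Comp C (pr X i) h"]
      comp_in[OF that(2) pr[OF that(1)]] that by metis
  define F where "F = \<lparr> FObj = Pr, FArr = (\<lambda>f. tup (Cod ?D f) (Pr (Dom ?D f))
      (\<lambda>i. Comp C (f i) (pr (Dom ?D f) i))) \<rparr>"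
  have homD: "f i \<in> Hom C (X i) (Y i)"
    if "f \<in> Hom ?D X Y" "X \<in> Obj ?D" "Y \<in> Obj ?D" "i \<in> I" for f X Y i
    using that by (auto simp: Hom_power_cat)
  have F: "FArr F f \<in> Hom C (Pr X) (Pr Y)"
      "i \<in> I \<Longrightarrow> Comp C (pr Y i) (FArr F f) = Comp C (f i) (pr X i)"
    if "f \<in> Hom ?D X Y" "X \<in> Obj ?D" "Y \<in> Obj ?D" for f X Y i
  proof -
    have "Dom ?D f = X" "Cod ?D f = Y" using that(1) by (auto simp: Hom_def)
    then show "FArr F f \<in> Hom C (Pr X) (Pr Y)"
      "i \<in> I \<Longrightarrow> Comp C (pr Y i) (FArr F f) = Comp C (f i) (pr X i)"
      using tup[OF that(3) Pr[OF that(2)], of "\<lambda>i. Comp C (f i) (pr X i)"]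
        comp_in[OF pr[OF that(2)] homD[OF that]]
      by (auto simp: F_def)
  qed
  have compD: "i \<in> I \<Longrightarrow> Comp ?D g f i = Comp C (g i) (f i)" for g f i
    by (simp add: power_cat_def)
  interpret D: category ?D by (rule category_power_cat)
  have functor_F: "is_functor ?D C F"
    unfolding is_functor_def
  proof (intro conjI ballI)
    fix X assume X: "X \<in> Obj ?D"
    then show "FObj F X \<in> Obj C" using Pr by (simp add: F_def)
    have "FArr F (Ident ?D X) = Ident C (Pr X)"
    proof (rule uniq[OF X])
      note id = D.ident_in[OF X]
      show "FArr F (Ident ?D X) \<in> Hom C (Pr X) (Pr X)" using F(1)[OF id X X] .
      show "Ident C (Pr X) \<in> Hom C (Pr X) (Pr X)" using ident_in Pr X by blast
      fix i assume i: "i \<in> I"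
      then have "Ident ?D X i = Ident C (X i)" by (simp add: power_cat_def)
      then show "Comp C (pr X i) (FArr F (Ident ?D X)) = Comp C (pr X i) (Ident C (Pr X))"
        using F(2)[OF id X X i] pr[OF X i] comp_ident_left comp_ident_right by metis
    qed
    then show "FArr F (Ident ?D X) = Ident C (FObj F X)" by (simp add: F_def)
  next
    fix X Y f assume "X \<in> Obj ?D" "Y \<in> Obj ?D" "f \<in> Hom ?D X Y"
    then show "FArr F f \<in> Hom C (FObj F X) (FObj F Y)" using F(1) by (simp add: F_def)
  next
    fix X Y Z f g assume X: "X \<in> Obj ?D" and Y: "Y \<in> Obj ?D" and Z: "Z \<in> Obj ?D"
      and f: "f \<in> Hom ?D X Y" and g: "g \<in> Hom ?D Y Z"
    note gf = D.comp_in[OF f g]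
    show "FArr F (Comp ?D g f) = Comp C (FArr F g) (FArr F f)"
    proof (rule uniq[OF Z])
      show "FArr F (Comp ?D g f) \<in> Hom C (Pr X) (Pr Z)" using F(1)[OF gf X Z] .
      show "Comp C (FArr F g) (FArr F f) \<in> Hom C (Pr X) (Pr Z)"
        using comp_in[OF F(1)[OF f X Y] F(1)[OF g Y Z]] .
      fix i assume i: "i \<in> I"
      have "Comp C (pr Z i) (Comp C (FArr F g) (FArr F f)) =
          Comp C (Comp C (g i) (pr Y i)) (FArr F f)"
        using comp_assoc[OF F(1)[OF f X Y] F(1)[OF g Y Z] pr[OF Z i]] F(2)[OF g Y Z i] by simp
      also have "\<dots> = Comp C (g i) (Comp C (f i) (pr X i))"
        using comp_assoc[OF F(1)[OF f X Y] pr[OF Y i] homD[OF g Y Z i]] F(2)[OF f X Y i] by simp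
      also have "\<dots> = Comp C (Comp C (g i) (f i)) (pr X i)"
        using comp_assoc[OF pr[OF X i] homD[OF f X Y i] homD[OF g Y Z i]] .
      finally show "Comp C (pr Z i) (FArr F (Comp ?D g f)) =
          Comp C (pr Z i) (Comp C (FArr F g) (FArr F f))"
        using F(2)[OF gf X Z i] compD[OF i] by simp
    qed
  qed
  have diagO: "FObj (diag C I) A \<in> Obj ?D" "i \<in> I \<Longrightarrow> FObj (diag C I) A i = A"
    if "A \<in> Obj C" for A i
    using that by (auto simp: diag_def Obj_power_cat)
  define \<phi> where "\<phi> A Y f = tup Y A f" for A Y f
  have inA: "f i \<in> Hom C A (Y i)" if "A \<in> Obj C" "Y \<in> Obj ?D" "i \<in> I"
      "f \<in> Hom ?D (FObj (diag C I) A) Y" for A Y f i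
    using homD[OF that(4) diagO(1)[OF that(1)] that(2,3)] diagO(2) that by metis
  have \<phi>: "\<phi> A Y f \<in> Hom C A (Pr Y)" "i \<in> I \<Longrightarrow> Comp C (pr Y i) (\<phi> A Y f) = f i"
    if "A \<in> Obj C" "Y \<in> Obj ?D" "f \<in> Hom ?D (FObj (diag C I) A) Y" for A Y f i
    using tup[OF that(2,1) inA[OF that(1,2) _ that(3)]] by (auto simp: \<phi>_def)
  have bij: "bij_betw (\<phi> A Y) (Hom ?D (FObj (diag C I) A) Y) (Hom C A (FObj F Y))"
    if A: "A \<in> Obj C" and Y: "Y \<in> Obj ?D" for A Y
  proof (rule bij_betw_byWitness[where f' = "\<lambda>h. \<lambda>i\<in>I. Comp C (pr Y i) h"])
    have H: "Hom ?D (FObj (diag C I) A) Y = (\<Pi>\<^sub>E i\<in>I. Hom C A (Y i))"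
      using Hom_power_cat[OF diagO(1)[OF A] Y] diagO(2)[OF A] by (auto cong: PiE_cong)
    show "\<forall>f\<in>Hom ?D (FObj (diag C I) A) Y. (\<lambda>i\<in>I. Comp C (pr Y i) (\<phi> A Y f)) = f"
      using \<phi>(2)[OF A Y] unfolding H by (auto simp: fun_eq_iff PiE_iff extensional_def)
    show im: "(\<lambda>h. \<lambda>i\<in>I. Comp C (pr Y i) h) ` Hom C A (FObj F Y) \<subseteq> Hom ?D (FObj (diag C I) A) Y"
      unfolding H using comp_in pr[OF Y] by (fastforce simp: F_def)
    show "\<phi> A Y ` Hom ?D (FObj (diag C I) A) Y \<subseteq> Hom C A (FObj F Y)"
      using \<phi>(1)[OF A Y] by (auto simp: F_def)
    show "\<forall>h\<in>Hom C A (FObj F Y). \<phi> A Y (\<lambda>i\<in>I. Comp C (pr Y i) h) = h"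
    proof
      fix h assume h: "h \<in> Hom C A (FObj F Y)"
      then have m: "(\<lambda>i\<in>I. Comp C (pr Y i) h) \<in> Hom ?D (FObj (diag C I) A) Y" using im by blast
      show "\<phi> A Y (\<lambda>i\<in>I. Comp C (pr Y i) h) = h"
      proof (rule uniq[OF Y])
        show "\<phi> A Y (\<lambda>i\<in>I. Comp C (pr Y i) h) \<in> Hom C A (Pr Y)" using \<phi>(1)[OF A Y m] .
        show "h \<in> Hom C A (Pr Y)" using h by (simp add: F_def)
        fix i assume "i \<in> I"
        then show "Comp C (pr Y i) (\<phi> A Y (\<lambda>i\<in>I. Comp C (pr Y i) h)) = Comp C (pr Y i) h"
          using \<phi>(2)[OF A Y m] by simp
      qed
    qed
  qed
  have nat: "\<phi> A' Y' (Comp ?D v (Comp ?D f (FArr (diag C I) u))) =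
      Comp C (FArr F v) (Comp C (\<phi> A Y f) u)"
    if A: "A \<in> Obj C" and A': "A' \<in> Obj C" and Y: "Y \<in> Obj ?D" and Y': "Y' \<in> Obj ?D"
      and u: "u \<in> Hom C A' A" and v: "v \<in> Hom ?D Y Y'"
      and f: "f \<in> Hom ?D (FObj (diag C I) A) Y" for A A' Y Y' u v f
  proof (rule uniq[OF Y'])
    have du: "FArr (diag C I) u \<in> Hom ?D (FObj (diag C I) A') (FObj (diag C I) A)"
      using is_functor_diag[OF category_axioms] A A' u unfolding is_functor_def by blast
    note m = D.comp_in[OF D.comp_in[OF du f] v]
    note w = comp_in[OF u \<phi>(1)[OF A Y f]]
    show "\<phi> A' Y' (Comp ?D v (Comp ?D f (FArr (diag C I) u))) \<in> Hom C A' (Pr Y')"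
      using \<phi>(1)[OF A' Y' m] .
    show "Comp C (FArr F v) (Comp C (\<phi> A Y f) u) \<in> Hom C A' (Pr Y')"
      using comp_in[OF w F(1)[OF v Y Y']] .
    fix i assume i: "i \<in> I"
    have "Comp C (pr Y' i) (Comp C (FArr F v) (Comp C (\<phi> A Y f) u)) =
        Comp C (Comp C (v i) (pr Y i)) (Comp C (\<phi> A Y f) u)"
      using comp_assoc[OF w F(1)[OF v Y Y'] pr[OF Y' i]] F(2)[OF v Y Y' i] by simp
    also have "\<dots> = Comp C (v i) (Comp C (pr Y i) (Comp C (\<phi> A Y f) u))"
      using comp_assoc[OF w pr[OF Y i] homD[OF v Y Y' i]] by simp
    also have "\<dots> = Comp C (v i) (Comp C (f i) u)"
      using comp_assoc[OF u \<phi>(1)[OF A Y f] pr[OF Y i]] \<phi>(2)[OF A Y f i] by simp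
    finally show "Comp C (pr Y' i) (\<phi> A' Y' (Comp ?D v (Comp ?D f (FArr (diag C I) u)))) =
        Comp C (pr Y' i) (Comp C (FArr F v) (Comp C (\<phi> A Y f) u))"
      using \<phi>(2)[OF A' Y' m i] i by (simp add: compD diag_def)
  qed
  have "is_product_functor C I F"
    unfolding is_product_functor_def adjoint_def
    using is_functor_diag[OF category_axioms] functor_F bij nat by blast
  then show ?thesis ..
qed

text \<open>The coproduct case follows by passing to the opposite category.\<close>

definition op_cat :: "('o, 'a, 'm) cat_scheme \<Rightarrow> ('o, 'a) cat" where
  "op_cat C = \<lparr> Obj = Obj C, Arr = Arr C, Dom = Cod C, Cod = Dom C, Ident = Ident C,
     Comp = (\<lambda>g f. Comp C f g) \<rparr>"

lemma op_cat_simps: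
  "Obj (op_cat C) = Obj C" "Ident (op_cat C) = Ident C"
  "Comp (op_cat C) g f = Comp C f g" "Hom (op_cat C) A B = Hom C B A"
  by (auto simp: op_cat_def Hom_def)

lemma (in category) category_op_cat: "category (op_cat C)"
  using dom_in cod_in ident_in comp_in comp_ident_left comp_ident_right comp_assoc
  by unfold_locales (auto simp: op_cat_simps, auto simp: op_cat_def)

lemma power_cat_op_cat: "power_cat (op_cat C) I = op_cat (power_cat C I)"
  by (simp add: power_cat_def op_cat_def)

lemma is_functor_op_cat: "is_functor (op_cat C) (op_cat D) F \<longleftrightarrow> is_functor C D F"
  unfolding is_functor_def op_cat_simps by blast

lemma (in category) coproduct_functor_exists:
  assumes "has_coproducts C I"
  shows "\<exists>S. is_coproduct_functor C I S"
proof -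
  let ?D = "power_cat C I"
  interpret D: category ?D by (rule category_power_cat)
  interpret O: category "op_cat C" by (rule category_op_cat)
  have "has_products (op_cat C) I"
    using assms
    by (simp add: has_products_def has_coproducts_def is_product_def is_coproduct_def op_cat_simps)
  moreover have "diag (op_cat C) I = diag C I"
    by (simp add: diag_def)
  ultimately obtain S where "adjoint (op_cat C) (op_cat ?D) (diag C I) S"
    using O.product_functor_exists[of I] unfolding is_product_functor_def power_cat_op_cat
    by metis
  then obtain \<phi> where S: "is_functor ?D C S" and d: "is_functor C ?D (diag C I)"
    and bij: "\<And>A Y. A \<in> Obj C \<Longrightarrow> Y \<in> Obj ?D \<Longrightarrow>
      bij_betw (\<phi> A Y) (Hom ?D Y (FObj (diag C I) A)) (Hom C (FObj S Y) A)"
    and nat: "\<And>A A' Y Y' u v f. \<lbrakk>A \<in> Obj C; A' \<in> Obj C; Y \<in> Obj ?D; Y' \<in> Obj ?D;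
        u \<in> Hom C A A'; v \<in> Hom ?D Y' Y; f \<in> Hom ?D Y (FObj (diag C I) A)\<rbrakk> \<Longrightarrow>
      \<phi> A' Y' (Comp ?D (Comp ?D (FArr (diag C I) u) f) v) =
      Comp C (Comp C u (\<phi> A Y f)) (FArr S v)"
    unfolding adjoint_def is_functor_op_cat op_cat_simps
    by blast
  define \<psi> where "\<psi> Y A = the_inv_into (Hom ?D Y (FObj (diag C I) A)) (\<phi> A Y)" for Y A
  have \<psi>_bij: "bij_betw (\<psi> Y A) (Hom C (FObj S Y) A) (Hom ?D Y (FObj (diag C I) A))"
    if "A \<in> Obj C" "Y \<in> Obj ?D" for A Y
    unfolding \<psi>_def by (rule bij_betw_the_inv_into[OF bij[OF that]])
  have \<psi>\<phi>: "\<psi> Y A (\<phi> A Y f) = f"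
    if "A \<in> Obj C" "Y \<in> Obj ?D" "f \<in> Hom ?D Y (FObj (diag C I) A)" for A Y f
    unfolding \<psi>_def using bij[OF that(1,2)] that(3) by (simp add: bij_betw_def the_inv_into_f_f)
  have \<phi>\<psi>: "\<phi> A Y (\<psi> Y A f) = f"
    if "A \<in> Obj C" "Y \<in> Obj ?D" "f \<in> Hom C (FObj S Y) A" for A Y f
    unfolding \<psi>_def using bij[OF that(1,2)] that(3) by (simp add: bij_betw_def f_the_inv_into_f)
  have "\<psi> Y' A' (Comp C u (Comp C f (FArr S v))) =
      Comp ?D (FArr (diag C I) u) (Comp ?D (\<psi> Y A f) v)"
    if Y: "Y \<in> Obj ?D" and Y': "Y' \<in> Obj ?D" and A: "A \<in> Obj C" and A': "A' \<in> Obj C"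
      and v: "v \<in> Hom ?D Y' Y" and u: "u \<in> Hom C A A'" and f: "f \<in> Hom C (FObj S Y) A"
    for A A' Y Y' u v f
  proof -
    have p: "\<psi> Y A f \<in> Hom ?D Y (FObj (diag C I) A)"
      using \<psi>_bij[OF A Y] f by (auto simp: bij_betw_def)
    have du: "FArr (diag C I) u \<in> Hom ?D (FObj (diag C I) A) (FObj (diag C I) A')"
      using d A A' u unfolding is_functor_def by blast
    have Sv: "FArr S v \<in> Hom C (FObj S Y') (FObj S Y)"
      using S Y Y' v unfolding is_functor_def by blast
    have "Comp C u (Comp C f (FArr S v)) =
        \<phi> A' Y' (Comp ?D (Comp ?D (FArr (diag C I) u) (\<psi> Y A f)) v)"
      using nat[OF A A' Y Y' u v p] \<phi>\<psi>[OF A Y f] comp_assoc[OF Sv f u] by simp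
    then show ?thesis
      using \<psi>\<phi>[OF A' Y' D.comp_in[OF v D.comp_in[OF p du]]] D.comp_assoc[OF v p du] by simp
  qed
  then have "is_coproduct_functor C I S"
    unfolding is_coproduct_functor_def adjoint_def using S d \<psi>_bij by blast
  then show ?thesis ..
qed


section \<open>Categories enriched in abelian monoids\<close>

text \<open>Distinct hom-sets are disjoint, so one operation \<open>Plus\<close> on arrows serves for all
  of them; it is only meaningful on parallel arrows.\<close>

record ('o, 'a) amon_cat = "('o, 'a) cat" +
  Plus :: "'a \<Rightarrow> 'a \<Rightarrow> 'a"
  Neutral :: "'o \<Rightarrow> 'o \<Rightarrow> 'a"

definition Hom_monoid :: "('o, 'a, 'm) amon_cat_scheme \<Rightarrow> 'o \<Rightarrow> 'o \<Rightarrow> 'a monoid" where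
  "Hom_monoid C A B = \<lparr> carrier = Hom C A B, mult = Plus C, one = Neutral C A B \<rparr>"

locale amon_category = category C for C :: "('o, 'a, 'm) amon_cat_scheme" +
  assumes hom_comm_monoid: "A \<in> Obj C \<Longrightarrow> B \<in> Obj C \<Longrightarrow> comm_monoid (Hom_monoid C A B)"
    and comp_plus_left: "f \<in> Hom C A B \<Longrightarrow> g \<in> Hom C B D \<Longrightarrow> g' \<in> Hom C B D \<Longrightarrow>
           Comp C (Plus C g g') f = Plus C (Comp C g f) (Comp C g' f)"
    and comp_plus_right: "f \<in> Hom C A B \<Longrightarrow> f' \<in> Hom C A B \<Longrightarrow> g \<in> Hom C B D \<Longrightarrow>
           Comp C g (Plus C f f') = Plus C (Comp C g f) (Comp C g f')"
    and comp_neutral_left: "f \<in> Hom C A B \<Longrightarrow> D \<in> Obj C \<Longrightarrow>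
           Comp C (Neutral C B D) f = Neutral C A D"
    and comp_neutral_right: "g \<in> Hom C B D \<Longrightarrow> A \<in> Obj C \<Longrightarrow>
           Comp C g (Neutral C A B) = Neutral C A D"

definition add_invertible :: "('o, 'a, 'm) amon_cat_scheme \<Rightarrow> 'o \<Rightarrow> 'o \<Rightarrow> 'a \<Rightarrow> bool" where
  "add_invertible C X Y f \<longleftrightarrow> f \<in> Hom C X Y \<and> (\<exists>g \<in> Hom C X Y. Plus C f g = zero_mor C X Y)"

lemma (in amon_category) neutral_in:
  assumes "A \<in> Obj C" "B \<in> Obj C"
  shows "Neutral C A B \<in> Hom C A B"
  using monoid.one_closed[OF comm_monoid.axioms(1)[OF hom_comm_monoid[OF assms]]]
  by (simp add: Hom_monoid_def)

lemma (in amon_category) zero_mor_eq_neutral: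
  assumes Z: "zero_object C Z" and A: "A \<in> Obj C" and B: "B \<in> Obj C"
  shows "zero_mor C A B = Neutral C A B"
proof -
  have eq: "Comp C v u = Neutral C A B"
    if "zero_object C Z'" "u \<in> Hom C A Z'" "v \<in> Hom C Z' B" for Z' u v
  proof -
    have Z': "Z' \<in> Obj C" using that(1) by (simp add: zero_object_def initial_object_def)
    have "v = Neutral C Z' B"
      using that neutral_in[OF Z' B] B by (auto simp: zero_object_def initial_object_def)
    then show ?thesis using comp_neutral_left[OF that(2) B] by simp
  qed
  obtain u v where "u \<in> Hom C A Z" "v \<in> Hom C Z B"
    using Z A B by (metis zero_object_def initial_object_def terminal_object_def)
  note uv = this
  show ?thesis
    unfolding zero_mor_def
  proof (rule the_equality)
    show "\<exists>Z u v. zero_object C Z \<and> u \<in> Hom C A Z \<and> v \<in> Hom C Z B \<and>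
            Neutral C A B = Comp C v u"
      using Z uv eq[OF Z uv] by metis
  next
    fix h
    assume "\<exists>Z u v. zero_object C Z \<and> u \<in> Hom C A Z \<and> v \<in> Hom C Z B \<and> h = Comp C v u"
    then show "h = Neutral C A B" using eq by blast
  qed
qed

end

theory Submission
  imports Defs
begin

text \<open>A morphism from \<open>\<Oplus>X\<^sub>i\<close> to \<open>\<Prod>X\<^sub>i\<close> is the same thing as a matrix of morphisms
  \<open>X\<^sub>i \<rightarrow> X\<^sub>j\<close>, and addition of arrows makes the identity matrix (\<open>delta\<close>: identities on the
  diagonal, neutral morphisms elsewhere) available.
  The morphism with this matrix is natural in the family.

  If \<open>I\<close> is finite, the morphism with identity matrix has the inverse
  \<open>\<Sum>\<^sub>i s\<^sub>i p\<^sub>i\<close>, where \<open>s\<^sub>i\<close> are the injections and \<open>p\<^sub>i\<close> the projections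
  (\<open>iso_coproduct_product_finite\<close>); so the two functors are isomorphic.

  Conversely, let \<open>\<tau>\<close> be any natural isomorphism from \<open>\<Oplus>\<close> to \<open>\<Prod>\<close> and consider a constant
  family \<open>X\<close>. Naturality with respect to the endomorphism of the family that is the identity at
  \<open>i\<close> and neutral elsewhere forces the matrix of \<open>\<tau>\<close> to be diagonal, and the same naturality for
  the inverse of \<open>\<tau>\<close> shows that the diagonal entries are invertible. Rescaling by them makes
  the object \<open>S = \<Oplus>X\<close> a product as well, with projections \<open>\<pi>\<^sub>i\<close> such that
  \<open>\<pi>\<^sub>j s\<^sub>i = delta\<close> (\<open>coproduct_is_product_if_iso\<close>).
  Every constant family of morphisms \<open>f: X \<rightarrow> Y\<close> then has a sum \<open>\<Sum>\<^sub>I f\<close>, the composite of the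
  diagonal \<open>u: X \<rightarrow> S\<close> with the codiagonal \<open>S \<rightarrow> Y\<close> of \<open>f\<close>. If \<open>I\<close> is infinite, it is in
  bijection with \<open>I\<close> minus a point, which gives \<open>\<Sum>\<^sub>I f = \<Sum>\<^sub>I f + f\<close>. If moreover \<open>f + g = 0\<close>,
  then \<open>\<Sum>\<^sub>I f + \<Sum>\<^sub>I g = 0\<close>, so \<open>\<Sum>\<^sub>I f\<close> can be cancelled and \<open>f = 0\<close>
  (\<open>add_invertible_zero_if_infinite_biproduct\<close>). Hence an invertible nonzero morphism excludes an
  isomorphism of the functors over an infinite \<open>I\<close>.\<close>

section \<open>Universal cones of the product and coproduct functors\<close>

lemma power_cat_simps:
  "Comp (power_cat C I) g f = (\<lambda>i\<in>I. Comp C (g i) (f i))"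
  "Ident (power_cat C I) X = (\<lambda>i\<in>I. Ident C (X i))"
  by (simp_all add: power_cat_def)

lemma diag_simps:
  "FObj (diag C I) A = (\<lambda>i\<in>I. A)" "FArr (diag C I) f = (\<lambda>i\<in>I. f)"
  by (simp_all add: diag_def)

lemma functor_arr:
  assumes "is_functor C D F" "A \<in> Obj C" "B \<in> Obj C" "f \<in> Hom C A B"
  shows "FArr F f \<in> Hom D (FObj F A) (FObj F B)"
  using assms by (simp add: is_functor_def)

lemma coproduct_functor_is_functor:
  "is_coproduct_functor C I S \<Longrightarrow> is_functor (power_cat C I) C S"
  by (simp add: is_coproduct_functor_def adjoint_def)

lemma product_functor_is_functor:
  "is_product_functor C I P \<Longrightarrow> is_functor (power_cat C I) C P"
  by (simp add: is_product_functor_def adjoint_def)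

context category
begin

lemma Hom_from_diag:
  assumes "A \<in> Obj C" "X \<in> Obj (power_cat C I)"
  shows "Hom (power_cat C I) (FObj (diag C I) A) X = (\<Pi>\<^sub>E i\<in>I. Hom C A (X i))"
  using assms by (subst Hom_power_cat) (auto simp: diag_simps Obj_power_cat cong: PiE_cong)

lemma Hom_to_diag:
  assumes "A \<in> Obj C" "X \<in> Obj (power_cat C I)"
  shows "Hom (power_cat C I) X (FObj (diag C I) A) = (\<Pi>\<^sub>E i\<in>I. Hom C (X i) A)"
  using assms by (subst Hom_power_cat) (auto simp: diag_simps Obj_power_cat cong: PiE_cong)

text \<open>The injections into \<open>S X\<close> are the components of the unit of the adjunction at \<open>X\<close>, that is,
  the transpose of the identity of \<open>S X\<close>. Naturality of transposition in the second variable says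
  that the transpose of \<open>h\<close> is the family of composites \<open>h s\<^sub>i\<close>, so its bijectivity is the universal
  property; naturality in the first variable makes the injections natural.\<close>

lemma coproduct_functor_injections:
  assumes "is_coproduct_functor C I S"
  obtains s where
    "\<And>X. X \<in> Obj (power_cat C I) \<Longrightarrow> is_coproduct C I X (FObj S X) (s X)"
    "\<And>X Y f i. \<lbrakk>X \<in> Obj (power_cat C I); Y \<in> Obj (power_cat C I);
       f \<in> Hom (power_cat C I) X Y; i \<in> I\<rbrakk> \<Longrightarrow> Comp C (FArr S f) (s X i) = Comp C (s Y i) (f i)"
proof -
  let ?D = "power_cat C I"
  interpret D: category ?D by (rule category_power_cat)
  from assms obtain \<phi> where S: "is_functor ?D C S"
    and bij: "\<And>X A. X \<in> Obj ?D \<Longrightarrow> A \<in> Obj C \<Longrightarrow>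
      bij_betw (\<phi> X A) (Hom C (FObj S X) A) (Hom ?D X (FObj (diag C I) A))"
    and nat: "\<And>X X' A A' u v f. \<lbrakk>X \<in> Obj ?D; X' \<in> Obj ?D; A \<in> Obj C; A' \<in> Obj C;
        u \<in> Hom ?D X' X; v \<in> Hom C A A'; f \<in> Hom C (FObj S X) A\<rbrakk> \<Longrightarrow>
      \<phi> X' A' (Comp C v (Comp C f (FArr S u))) =
      Comp ?D (FArr (diag C I) v) (Comp ?D (\<phi> X A f) u)"
    unfolding is_coproduct_functor_def adjoint_def by blast
  define s where "s X = \<phi> X (FObj S X) (Ident C (FObj S X))" for X
  have SO: "FObj S X \<in> Obj C" if "X \<in> Obj ?D" for X
    using S that by (simp add: is_functor_def)
  have SI: "FArr S (Ident ?D X) = Ident C (FObj S X)" if "X \<in> Obj ?D" for X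
    using S that by (simp add: is_functor_def)
  have SA: "FArr S f \<in> Hom C (FObj S X) (FObj S Y)"
    if "X \<in> Obj ?D" "Y \<in> Obj ?D" "f \<in> Hom ?D X Y" for X Y f
    using S that unfolding is_functor_def by blast
  have s_in: "s X \<in> Hom ?D X (FObj (diag C I) (FObj S X))" if X: "X \<in> Obj ?D" for X
    using bij[OF X SO[OF X]] ident_in[OF SO[OF X]] by (auto simp: s_def bij_betw_def)
  have s: "s X i \<in> Hom C (X i) (FObj S X)" if "X \<in> Obj ?D" "i \<in> I" for X i
    using s_in[OF that(1)] that Hom_to_diag[OF SO[OF that(1)] that(1)] by (auto simp: PiE_iff)
  have \<phi>_eq: "\<phi> X A h = (\<lambda>i\<in>I. Comp C h (s X i))"
    if X: "X \<in> Obj ?D" and A: "A \<in> Obj C" and h: "h \<in> Hom C (FObj S X) A" for X A h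
  proof -
    have "\<phi> X A h = Comp ?D (FArr (diag C I) h) (s X)"
      using nat[OF X X SO[OF X] A D.ident_in[OF X] h ident_in[OF SO[OF X]]]
        comp_ident_right[OF h] comp_ident_right[OF ident_in[OF SO[OF X]]] SI[OF X]
        D.comp_ident_right[OF s_in[OF X]]
      by (simp add: s_def[symmetric])
    then show ?thesis by (simp add: power_cat_simps diag_simps cong: restrict_cong)
  qed
  show thesis
  proof (rule that)
    fix X assume X: "X \<in> Obj ?D"
    show "is_coproduct C I X (FObj S X) (s X)"
      unfolding is_coproduct_def
    proof (intro conjI ballI allI impI)
      show "FObj S X \<in> Obj C" by (rule SO[OF X])
      show "s X i \<in> Hom C (X i) (FObj S X)" if "i \<in> I" for i by (rule s[OF X that])
      fix Q q assume Q: "Q \<in> Obj C" and q: "\<forall>i\<in>I. q i \<in> Hom C (X i) Q"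
      have eq: "\<phi> X Q h = (\<lambda>i\<in>I. q i) \<longleftrightarrow> (\<forall>i\<in>I. Comp C h (s X i) = q i)"
        if "h \<in> Hom C (FObj S X) Q" for h
        using \<phi>_eq[OF X Q that] by (auto simp: fun_eq_iff restrict_def)
      have "(\<lambda>i\<in>I. q i) \<in> Hom ?D X (FObj (diag C I) Q)"
        using q by (simp add: Hom_to_diag[OF Q X])
      then obtain h where h: "h \<in> Hom C (FObj S X) Q" and \<phi>h: "\<phi> X Q h = (\<lambda>i\<in>I. q i)"
        unfolding bij_betw_imp_surj_on[OF bij[OF X Q], symmetric] by auto
      show "\<exists>!h. h \<in> Hom C (FObj S X) Q \<and> (\<forall>i\<in>I. Comp C h (s X i) = q i)"
      proof (rule ex1I[of _ h])
        show "h \<in> Hom C (FObj S X) Q \<and> (\<forall>i\<in>I. Comp C h (s X i) = q i)"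
          using h \<phi>h eq by blast
        fix h' assume h': "h' \<in> Hom C (FObj S X) Q \<and> (\<forall>i\<in>I. Comp C h' (s X i) = q i)"
        then have "\<phi> X Q h' = (\<lambda>i\<in>I. q i)" using eq by blast
        then show "h' = h"
          using inj_onD[OF bij_betw_imp_inj_on[OF bij[OF X Q]]] h h' \<phi>h by simp
      qed
    qed
  next
    fix X Y f i assume X: "X \<in> Obj ?D" and Y: "Y \<in> Obj ?D" and f: "f \<in> Hom ?D X Y" and i: "i \<in> I"
    have fi: "f i \<in> Hom C (X i) (Y i)" using f i by (simp add: Hom_power_cat[OF X Y] PiE_iff)
    have "\<phi> X (FObj S Y) (FArr S f) = Comp ?D (FArr (diag C I) (Ident C (FObj S Y))) (Comp ?D (s Y) f)"
      using nat[OF Y X SO[OF Y] SO[OF Y] f ident_in[OF SO[OF Y]] ident_in[OF SO[OF Y]]]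
        comp_ident_left[OF SA[OF X Y f]] by (simp add: s_def)
    then have "(\<lambda>i\<in>I. Comp C (FArr S f) (s X i)) i =
        Comp ?D (FArr (diag C I) (Ident C (FObj S Y))) (Comp ?D (s Y) f) i"
      using \<phi>_eq[OF X SO[OF Y] SA[OF X Y f]] by simp
    then show "Comp C (FArr S f) (s X i) = Comp C (s Y i) (f i)"
      using i comp_ident_left[OF comp_in[OF fi s[OF Y i]]] by (simp add: power_cat_simps diag_simps)
  qed
qed

text \<open>Dually, the projections are the components of the counit, the family whose transpose is the
  identity of \<open>P X\<close>. Transposition here goes from families to arrows, so equations between families
  are obtained by comparing transposes.\<close>

lemma product_functor_projections:
  assumes "is_product_functor C I P"
  obtains p where
    "\<And>X. X \<in> Obj (power_cat C I) \<Longrightarrow> is_product C I X (FObj P X) (p X)"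
    "\<And>X Y f i. \<lbrakk>X \<in> Obj (power_cat C I); Y \<in> Obj (power_cat C I);
       f \<in> Hom (power_cat C I) X Y; i \<in> I\<rbrakk> \<Longrightarrow> Comp C (p Y i) (FArr P f) = Comp C (f i) (p X i)"
proof -
  let ?D = "power_cat C I" and ?\<Delta> = "\<lambda>A. FObj (diag C I) A"
  interpret D: category ?D by (rule category_power_cat)
  from assms obtain \<phi> where P: "is_functor ?D C P" and d: "is_functor C ?D (diag C I)"
    and bij: "\<And>A X. A \<in> Obj C \<Longrightarrow> X \<in> Obj ?D \<Longrightarrow>
      bij_betw (\<phi> A X) (Hom ?D (?\<Delta> A) X) (Hom C A (FObj P X))"
    and nat: "\<And>A A' X X' u v f. \<lbrakk>A \<in> Obj C; A' \<in> Obj C; X \<in> Obj ?D; X' \<in> Obj ?D;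
        u \<in> Hom C A' A; v \<in> Hom ?D X X'; f \<in> Hom ?D (?\<Delta> A) X\<rbrakk> \<Longrightarrow>
      \<phi> A' X' (Comp ?D v (Comp ?D f (FArr (diag C I) u))) =
      Comp C (FArr P v) (Comp C (\<phi> A X f) u)"
    unfolding is_product_functor_def adjoint_def by blast
  have PO: "FObj P X \<in> Obj C" if "X \<in> Obj ?D" for X
    using P that by (simp add: is_functor_def)
  have PI: "FArr P (Ident ?D X) = Ident C (FObj P X)" if "X \<in> Obj ?D" for X
    using P that by (simp add: is_functor_def)
  have PA: "FArr P f \<in> Hom C (FObj P X) (FObj P Y)"
    if "X \<in> Obj ?D" "Y \<in> Obj ?D" "f \<in> Hom ?D X Y" for X Y f
    using P that unfolding is_functor_def by blast
  have dO: "?\<Delta> A \<in> Obj ?D" if "A \<in> Obj C" for A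
    using d that by (simp add: is_functor_def)
  have dA: "FArr (diag C I) u \<in> Hom ?D (?\<Delta> A) (?\<Delta> B)"
    if "A \<in> Obj C" "B \<in> Obj C" "u \<in> Hom C A B" for A B u
    using d that unfolding is_functor_def by blast
  have inj: "f = g" if "A \<in> Obj C" "X \<in> Obj ?D" "f \<in> Hom ?D (?\<Delta> A) X" "g \<in> Hom ?D (?\<Delta> A) X"
      "\<phi> A X f = \<phi> A X g" for A X f g
    using bij[OF that(1,2)] that(3-5) unfolding bij_betw_def inj_on_def by blast
  have "\<exists>f. f \<in> Hom ?D (?\<Delta> (FObj P X)) X \<and> \<phi> (FObj P X) X f = Ident C (FObj P X)"
    if "X \<in> Obj ?D" for X
    using ident_in[OF PO[OF that]]
    unfolding bij_betw_imp_surj_on[OF bij[OF PO[OF that] that], symmetric] by auto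
  then obtain p where p_in: "\<And>X. X \<in> Obj ?D \<Longrightarrow> p X \<in> Hom ?D (?\<Delta> (FObj P X)) X"
    and \<phi>p: "\<And>X. X \<in> Obj ?D \<Longrightarrow> \<phi> (FObj P X) X (p X) = Ident C (FObj P X)"
    by metis
  have p: "p X i \<in> Hom C (FObj P X) (X i)" if "X \<in> Obj ?D" "i \<in> I" for X i
    using p_in[OF that(1)] that Hom_from_diag[OF PO[OF that(1)] that(1)] by (auto simp: PiE_iff)
  have cone: "Comp ?D (p X) (FArr (diag C I) h) = (\<lambda>i\<in>I. Comp C (p X i) h)" for X h
    by (simp add: power_cat_simps diag_simps cong: restrict_cong)
  have cone_in: "Comp ?D (p X) (FArr (diag C I) h) \<in> Hom ?D (?\<Delta> A) X"
    if X: "X \<in> Obj ?D" and A: "A \<in> Obj C" and h: "h \<in> Hom C A (FObj P X)" for X A h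
    by (rule D.comp_in[OF dA[OF A PO[OF X] h] p_in[OF X]])
  have \<phi>_cone: "\<phi> A X (Comp ?D (p X) (FArr (diag C I) h)) = h"
    if X: "X \<in> Obj ?D" and A: "A \<in> Obj C" and h: "h \<in> Hom C A (FObj P X)" for X A h
    using nat[OF PO[OF X] A X X h D.ident_in[OF X] p_in[OF X]] \<phi>p[OF X] PI[OF X]
      comp_ident_left[OF h] D.comp_ident_left[OF cone_in[OF X A h]]
    by simp
  show thesis
  proof (rule that)
    fix X assume X: "X \<in> Obj ?D"
    show "is_product C I X (FObj P X) (p X)"
      unfolding is_product_def
    proof (intro conjI ballI allI impI)
      show "FObj P X \<in> Obj C" by (rule PO[OF X])
      show "p X i \<in> Hom C (FObj P X) (X i)" if "i \<in> I" for i by (rule p[OF X that])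
      fix Q q assume Q: "Q \<in> Obj C" and q: "\<forall>i\<in>I. q i \<in> Hom C Q (X i)"
      have q': "(\<lambda>i\<in>I. q i) \<in> Hom ?D (?\<Delta> Q) X"
        using q by (simp add: Hom_from_diag[OF Q X])
      then have h: "\<phi> Q X (\<lambda>i\<in>I. q i) \<in> Hom C Q (FObj P X)"
        using bij[OF Q X] by (auto simp: bij_betw_def)
      show "\<exists>!h. h \<in> Hom C Q (FObj P X) \<and> (\<forall>i\<in>I. Comp C (p X i) h = q i)"
      proof (rule ex1I[of _ "\<phi> Q X (\<lambda>i\<in>I. q i)"], intro conjI h)
        have "(\<lambda>i\<in>I. Comp C (p X i) (\<phi> Q X (\<lambda>i\<in>I. q i))) = (\<lambda>i\<in>I. q i)"
          using inj[OF Q X cone_in[OF X Q h] q' \<phi>_cone[OF X Q h]] cone by simp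
        then show "\<forall>i\<in>I. Comp C (p X i) (\<phi> Q X (\<lambda>i\<in>I. q i)) = q i"
          by (auto simp: fun_eq_iff restrict_def split: if_splits)
      next
        fix h' assume h': "h' \<in> Hom C Q (FObj P X) \<and> (\<forall>i\<in>I. Comp C (p X i) h' = q i)"
        then have "Comp ?D (p X) (FArr (diag C I) h') = (\<lambda>i\<in>I. q i)"
          by (simp add: cone cong: restrict_cong)
        then show "h' = \<phi> Q X (\<lambda>i\<in>I. q i)"
          using \<phi>_cone[OF X Q, of h'] h' by simp
      qed
    qed
  next
    fix X Y f i assume X: "X \<in> Obj ?D" and Y: "Y \<in> Obj ?D" and f: "f \<in> Hom ?D X Y" and i: "i \<in> I"
    have id: "Comp ?D (p X) (FArr (diag C I) (Ident C (FObj P X))) = p X"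
      using d PO[OF X] D.comp_ident_right[OF p_in[OF X]] by (simp add: is_functor_def)
    have "\<phi> (FObj P X) Y (Comp ?D f (p X)) = FArr P f"
      using nat[OF PO[OF X] PO[OF X] X Y ident_in[OF PO[OF X]] f p_in[OF X]] id \<phi>p[OF X]
        comp_ident_left[OF ident_in[OF PO[OF X]]] comp_ident_right[OF PA[OF X Y f]]
      by simp
    then have "Comp ?D (p Y) (FArr (diag C I) (FArr P f)) = Comp ?D f (p X)"
      using inj[OF PO[OF X] Y cone_in[OF Y PO[OF X] PA[OF X Y f]] D.comp_in[OF p_in[OF X] f]]
        \<phi>_cone[OF Y PO[OF X] PA[OF X Y f]] by simp
    from fun_cong[OF this, of i] show "Comp C (p Y i) (FArr P f) = Comp C (f i) (p X i)"
      using i by (simp add: power_cat_simps diag_simps)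
  qed
qed

lemma product_in:
  assumes "is_product C I X P p"
  shows "P \<in> Obj C" "i \<in> I \<Longrightarrow> p i \<in> Hom C P (X i)"
  using assms by (auto simp: is_product_def)

lemma coproduct_in:
  assumes "is_coproduct C I X S s"
  shows "S \<in> Obj C" "i \<in> I \<Longrightarrow> s i \<in> Hom C (X i) S"
  using assms by (auto simp: is_coproduct_def)

lemma product_ex1:
  assumes "is_product C I X P p" "Q \<in> Obj C" "\<And>i. i \<in> I \<Longrightarrow> q i \<in> Hom C Q (X i)"
  shows "\<exists>!h. h \<in> Hom C Q P \<and> (\<forall>i\<in>I. Comp C (p i) h = q i)"
  using assms by (simp add: is_product_def)

lemma coproduct_ex1:
  assumes "is_coproduct C I X S s" "Q \<in> Obj C" "\<And>i. i \<in> I \<Longrightarrow> q i \<in> Hom C (X i) Q"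
  shows "\<exists>!h. h \<in> Hom C S Q \<and> (\<forall>i\<in>I. Comp C h (s i) = q i)"
  using assms by (simp add: is_coproduct_def)

lemma product_eqI:
  assumes "is_product C I X P p" "h \<in> Hom C Q P" "h' \<in> Hom C Q P"
    "\<And>i. i \<in> I \<Longrightarrow> Comp C (p i) h = Comp C (p i) h'"
  shows "h = h'"
proof -
  have ex1: "\<exists>!k. k \<in> Hom C Q P \<and> (\<forall>i\<in>I. Comp C (p i) k = Comp C (p i) h)"
    by (rule product_ex1[OF assms(1) Hom_obj(1)[OF assms(2)]
          comp_in[OF assms(2) product_in(2)[OF assms(1)]]])
  show ?thesis using the1_equality[OF ex1, of h] the1_equality[OF ex1, of h'] assms(2-4) by simp
qed

lemma coproduct_eqI:
  assumes "is_coproduct C I X S s" "h \<in> Hom C S Q" "h' \<in> Hom C S Q"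
    "\<And>i. i \<in> I \<Longrightarrow> Comp C h (s i) = Comp C h' (s i)"
  shows "h = h'"
proof -
  have ex1: "\<exists>!k. k \<in> Hom C S Q \<and> (\<forall>i\<in>I. Comp C k (s i) = Comp C h (s i))"
    by (rule coproduct_ex1[OF assms(1) Hom_obj(2)[OF assms(2)]
          comp_in[OF coproduct_in(2)[OF assms(1)] assms(2)]])
  show ?thesis using the1_equality[OF ex1, of h] the1_equality[OF ex1, of h'] assms(2-4) by simp
qed

lemma productE:
  assumes "is_product C I X P p" "Q \<in> Obj C" "\<And>i. i \<in> I \<Longrightarrow> q i \<in> Hom C Q (X i)"
  obtains h where "h \<in> Hom C Q P" "\<And>i. i \<in> I \<Longrightarrow> Comp C (p i) h = q i"
  using ex1_implies_ex[OF product_ex1[where q = q, OF assms]] that by blast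

lemma coproductE:
  assumes "is_coproduct C I X S s" "Q \<in> Obj C" "\<And>i. i \<in> I \<Longrightarrow> q i \<in> Hom C (X i) Q"
  obtains h where "h \<in> Hom C S Q" "\<And>i. i \<in> I \<Longrightarrow> Comp C h (s i) = q i"
  using ex1_implies_ex[OF coproduct_ex1[where q = q, OF assms]] that by blast

end

section \<open>Addition of arrows\<close>

context amon_category
begin

lemma plus_in: "f \<in> Hom C A B \<Longrightarrow> g \<in> Hom C A B \<Longrightarrow> Plus C f g \<in> Hom C A B"
  using monoid.m_closed[OF comm_monoid.axioms(1)[OF hom_comm_monoid[of A B]], of f g] Hom_obj[of f A B]
  by (simp add: Hom_monoid_def)

lemma plus_comm: "f \<in> Hom C A B \<Longrightarrow> g \<in> Hom C A B \<Longrightarrow> Plus C f g = Plus C g f"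
  using comm_monoid.m_comm[OF hom_comm_monoid[of A B], of f g] Hom_obj[of f A B]
  by (simp add: Hom_monoid_def)

lemma plus_assoc: "f \<in> Hom C A B \<Longrightarrow> g \<in> Hom C A B \<Longrightarrow> h \<in> Hom C A B \<Longrightarrow>
    Plus C (Plus C f g) h = Plus C f (Plus C g h)"
  using monoid.m_assoc[OF comm_monoid.axioms(1)[OF hom_comm_monoid[of A B]], of f g h] Hom_obj[of f A B]
  by (simp add: Hom_monoid_def)

lemma plus_neutral:
  assumes "f \<in> Hom C A B"
  shows "Plus C (Neutral C A B) f = f" "Plus C f (Neutral C A B) = f"
  using monoid.l_one[OF comm_monoid.axioms(1)[OF hom_comm_monoid[of A B]], of f]
    monoid.r_one[OF comm_monoid.axioms(1)[OF hom_comm_monoid[of A B]], of f] Hom_obj[OF assms] assms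
  by (simp_all add: Hom_monoid_def)

text \<open>The entry of the identity matrix from \<open>X i\<close> to \<open>X j\<close>; the row index comes first, so that
  \<open>p j \<circ> c \<circ> s i\<close> is the entry of \<open>c\<close> at \<open>j i\<close>.\<close>

definition delta :: "('i \<Rightarrow> 'o) \<Rightarrow> 'i \<Rightarrow> 'i \<Rightarrow> 'a" where
  "delta X j i = (if i = j then Ident C (X i) else Neutral C (X i) (X j))"

lemma delta_in: "X i \<in> Obj C \<Longrightarrow> X j \<in> Obj C \<Longrightarrow> delta X j i \<in> Hom C (X i) (X j)"
  by (auto simp: delta_def ident_in neutral_in)

section \<open>Finite index sets\<close>

text \<open>The inverse of \<open>c\<close> is \<open>\<Sum>\<^sub>i s\<^sub>i p\<^sub>i\<close>. The partial sum \<open>h\<close> over \<open>J \<subseteq> I\<close> is built by adding one term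
  at a time; the invariant is that \<open>h c\<close> and \<open>c h\<close> act as the identity on the components in \<open>J\<close>
  and as the neutral morphism on the others, which for \<open>J = I\<close> says that \<open>h\<close> is a two-sided inverse.\<close>

lemma iso_coproduct_product_finite:
  assumes fin: "finite I" and X: "\<And>i. i \<in> I \<Longrightarrow> X i \<in> Obj C"
    and S: "is_coproduct C I X S s" and P: "is_product C I X P p"
    and c: "c \<in> Hom C S P"
    and cd: "\<And>i j. i \<in> I \<Longrightarrow> j \<in> I \<Longrightarrow> Comp C (p j) (Comp C c (s i)) = delta X j i"
  shows "iso_arr C S P c"
proof -
  note s = coproduct_in(2)[OF S] and p = product_in(2)[OF P]
  note PO = product_in(1)[OF P] and SO = coproduct_in(1)[OF S]
  have "\<exists>h \<in> Hom C P S.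
      (\<forall>i\<in>I. Comp C (Comp C h c) (s i) = (if i \<in> J then s i else Neutral C (X i) S)) \<and>
      (\<forall>j\<in>I. Comp C (p j) (Comp C c h) = (if j \<in> J then p j else Neutral C P (X j)))"
    if "finite J" "J \<subseteq> I" for J
    using that
  proof (induction J rule: finite_induct)
    case empty
    then show ?case
      using c s p X PO SO neutral_in comp_neutral_left comp_neutral_right
      by (auto intro!: bexI[of _ "Neutral C P S"])
  next
    case (insert k J)
    then obtain h where h: "h \<in> Hom C P S"
      and h1: "\<And>i. i \<in> I \<Longrightarrow>
        Comp C (Comp C h c) (s i) = (if i \<in> J then s i else Neutral C (X i) S)"
      and h2: "\<And>j. j \<in> I \<Longrightarrow>
        Comp C (p j) (Comp C c h) = (if j \<in> J then p j else Neutral C P (X j))"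
      by auto
    have k: "k \<in> I" "k \<notin> J" using insert by auto
    let ?t = "Comp C (s k) (p k)"
    have t: "?t \<in> Hom C P S" using comp_in[OF p s] k by blast
    show ?case
    proof (intro bexI[of _ "Plus C h ?t"] conjI ballI)
      show "Plus C h ?t \<in> Hom C P S" by (rule plus_in[OF h t])
    next
      fix i assume i: "i \<in> I"
      have "Comp C (Comp C ?t c) (s i) = Comp C (s k) (Comp C (p k) (Comp C c (s i)))"
        using comp_assoc[OF s[OF i] c t] comp_assoc[OF comp_in[OF s[OF i] c] p[OF k(1)] s[OF k(1)]]
        by simp
      also have "\<dots> = (if i = k then s i else Neutral C (X i) S)"
        using cd[OF i k(1)] comp_ident_right[OF s[OF i]] comp_neutral_right[OF s[OF k(1)] X[OF i]]
        by (auto simp: delta_def)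
      finally have e: "Comp C (Comp C ?t c) (s i) = (if i = k then s i else Neutral C (X i) S)" .
      show "Comp C (Comp C (Plus C h ?t) c) (s i) =
          (if i \<in> insert k J then s i else Neutral C (X i) S)"
        using comp_plus_left[OF c h t] comp_plus_left[OF s[OF i] comp_in[OF c h] comp_in[OF c t]]
          h1[OF i] e k(2) plus_neutral[OF s[OF i]] plus_neutral[OF neutral_in[OF X[OF i] SO]] by auto
    next
      fix j assume j: "j \<in> I"
      have "Comp C (p j) (Comp C c ?t) = Comp C (Comp C (p j) (Comp C c (s k))) (p k)"
        using comp_assoc[OF p[OF k(1)] s[OF k(1)] c]
          comp_assoc[OF p[OF k(1)] comp_in[OF s[OF k(1)] c] p[OF j]]
        by simp
      also have "\<dots> = (if j = k then p j else Neutral C P (X j))"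
        using cd[OF k(1) j] comp_ident_left[OF p[OF j]] comp_neutral_left[OF p[OF k(1)] X[OF j]]
        by (auto simp: delta_def)
      finally have e: "Comp C (p j) (Comp C c ?t) = (if j = k then p j else Neutral C P (X j))" .
      show "Comp C (p j) (Comp C c (Plus C h ?t)) =
          (if j \<in> insert k J then p j else Neutral C P (X j))"
        using comp_plus_right[OF h t c] comp_plus_right[OF comp_in[OF h c] comp_in[OF t c] p[OF j]]
          h2[OF j] e k(2) plus_neutral[OF p[OF j]] plus_neutral[OF neutral_in[OF PO X[OF j]]] by auto
    qed
  qed
  from this[OF fin order_refl] obtain h where h: "h \<in> Hom C P S"
    and h1: "\<And>i. i \<in> I \<Longrightarrow> Comp C (Comp C h c) (s i) = s i"
    and h2: "\<And>j. j \<in> I \<Longrightarrow> Comp C (p j) (Comp C c h) = p j"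
    by auto
  have "Comp C h c = Ident C S"
    using coproduct_eqI[OF S comp_in[OF c h] ident_in[OF SO]] h1 comp_ident_left[OF s] by auto
  moreover have "Comp C c h = Ident C P"
    using product_eqI[OF P comp_in[OF h c] ident_in[OF PO]] h2 comp_ident_right[OF p] by auto
  ultimately show ?thesis using c h unfolding iso_arr_def by blast
qed

text \<open>The isomorphism at \<open>X\<close> is the arrow with identity matrix. It is natural because the matrices of
  both composites with a family \<open>f\<close> have \<open>f i\<close> at the diagonal place \<open>i\<close> and neutral morphisms
  elsewhere.\<close>

lemma naturally_isomorphic_finite:
  assumes fin: "finite I"
    and S: "is_coproduct_functor C I S" and P: "is_product_functor C I P"
  shows "naturally_isomorphic (power_cat C I) C S P"
proof -
  let ?D = "power_cat C I"
  obtain s where s: "\<And>X. X \<in> Obj ?D \<Longrightarrow> is_coproduct C I X (FObj S X) (s X)"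
    and sn: "\<And>X Y f i. \<lbrakk>X \<in> Obj ?D; Y \<in> Obj ?D; f \<in> Hom ?D X Y; i \<in> I\<rbrakk> \<Longrightarrow>
       Comp C (FArr S f) (s X i) = Comp C (s Y i) (f i)"
    using coproduct_functor_injections[OF S] by metis
  obtain p where p: "\<And>X. X \<in> Obj ?D \<Longrightarrow> is_product C I X (FObj P X) (p X)"
    and pn: "\<And>X Y f i. \<lbrakk>X \<in> Obj ?D; Y \<in> Obj ?D; f \<in> Hom ?D X Y; i \<in> I\<rbrakk> \<Longrightarrow>
       Comp C (p Y i) (FArr P f) = Comp C (f i) (p X i)"
    using product_functor_projections[OF P] by metis
  have XO: "X i \<in> Obj C" if "X \<in> Obj ?D" "i \<in> I" for X i
    using that by (auto simp: Obj_power_cat)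
  have SA: "FArr S f \<in> Hom C (FObj S X) (FObj S Y)" and PA: "FArr P f \<in> Hom C (FObj P X) (FObj P Y)"
    if "X \<in> Obj ?D" "Y \<in> Obj ?D" "f \<in> Hom ?D X Y" for X Y f
    using functor_arr[OF coproduct_functor_is_functor[OF S] that]
      functor_arr[OF product_functor_is_functor[OF P] that] .
  have "\<exists>c \<in> Hom C (FObj S X) (FObj P X). \<forall>i\<in>I. \<forall>j\<in>I.
      Comp C (p X j) (Comp C c (s X i)) = delta X j i" if X: "X \<in> Obj ?D" for X
  proof -
    have "\<exists>r \<in> Hom C (X i) (FObj P X). \<forall>j\<in>I. Comp C (p X j) r = delta X j i" if i: "i \<in> I" for i
      using productE[OF p[OF X] XO[OF X i], of "\<lambda>j. delta X j i"] delta_in XO[OF X] i by metis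
    then obtain r where r: "\<And>i. i \<in> I \<Longrightarrow> r i \<in> Hom C (X i) (FObj P X)"
      "\<And>i j. i \<in> I \<Longrightarrow> j \<in> I \<Longrightarrow> Comp C (p X j) (r i) = delta X j i" by metis
    obtain c where c: "c \<in> Hom C (FObj S X) (FObj P X)" and cs: "\<And>i. i \<in> I \<Longrightarrow> Comp C c (s X i) = r i"
      using coproductE[OF s[OF X] product_in(1)[OF p[OF X]] r(1)] by metis
    show ?thesis using c by (rule bexI[rotated]) (simp add: cs r(2))
  qed
  then obtain c where c: "\<And>X. X \<in> Obj ?D \<Longrightarrow> c X \<in> Hom C (FObj S X) (FObj P X)"
    and cd: "\<And>X i j. \<lbrakk>X \<in> Obj ?D; i \<in> I; j \<in> I\<rbrakk> \<Longrightarrow>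
      Comp C (p X j) (Comp C (c X) (s X i)) = delta X j i"
    by metis
  have "natural_iso ?D C S P c"
    unfolding natural_iso_def
  proof (intro conjI ballI)
    show "iso_arr C (FObj S X) (FObj P X) (c X)" if X: "X \<in> Obj ?D" for X
      using iso_coproduct_product_finite[OF fin XO[OF X] s[OF X] p[OF X] c[OF X] cd[OF X]] .
  next
    fix X Y f assume X: "X \<in> Obj ?D" and Y: "Y \<in> Obj ?D" and f: "f \<in> Hom ?D X Y"
    note Sf = SA[OF X Y f] and Pf = PA[OF X Y f]
    note sX = coproduct_in(2)[OF s[OF X]] and sY = coproduct_in(2)[OF s[OF Y]]
    note pX = product_in(2)[OF p[OF X]] and pY = product_in(2)[OF p[OF Y]]
    show "Comp C (c Y) (FArr S f) = Comp C (FArr P f) (c X)"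
    proof (rule coproduct_eqI[OF s[OF X] comp_in[OF Sf c[OF Y]] comp_in[OF c[OF X] Pf]])
      fix i assume i: "i \<in> I"
      have fi: "f k \<in> Hom C (X k) (Y k)" if "k \<in> I" for k
        using f that by (simp add: Hom_power_cat[OF X Y] PiE_iff)
      note l = comp_in[OF comp_in[OF fi[OF i] sY[OF i]] c[OF Y]]
      note r = comp_in[OF comp_in[OF sX[OF i] c[OF X]] Pf]
      have "Comp C (c Y) (Comp C (s Y i) (f i)) = Comp C (FArr P f) (Comp C (c X) (s X i))"
      proof (rule product_eqI[OF p[OF Y] l r])
        fix j assume j: "j \<in> I"
        have "Comp C (p Y j) (Comp C (c Y) (Comp C (s Y i) (f i))) = Comp C (delta Y j i) (f i)"
          using comp_assoc[OF fi[OF i] sY[OF i] c[OF Y]]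
            comp_assoc[OF fi[OF i] comp_in[OF sY[OF i] c[OF Y]] pY[OF j]] cd[OF Y i j]
          by simp
        also have "\<dots> = Comp C (f j) (delta X j i)"
          using comp_ident_left[OF fi[OF i]] comp_ident_right[OF fi[OF i]]
            comp_neutral_left[OF fi[OF i] XO[OF Y j]] comp_neutral_right[OF fi[OF j] XO[OF X i]]
          by (auto simp: delta_def)
        also have "\<dots> = Comp C (p Y j) (Comp C (FArr P f) (Comp C (c X) (s X i)))"
          using comp_assoc[OF comp_in[OF sX[OF i] c[OF X]] pX[OF j] fi[OF j]]
            comp_assoc[OF comp_in[OF sX[OF i] c[OF X]] Pf pY[OF j]] pn[OF X Y f j] cd[OF X i j]
          by simp
        finally show "Comp C (p Y j) (Comp C (c Y) (Comp C (s Y i) (f i))) =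
          Comp C (p Y j) (Comp C (FArr P f) (Comp C (c X) (s X i)))" .
      qed
      then show "Comp C (Comp C (c Y) (FArr S f)) (s X i) = Comp C (Comp C (FArr P f) (c X)) (s X i)"
        using comp_assoc[OF sX[OF i] Sf c[OF Y]] comp_assoc[OF sX[OF i] c[OF X] Pf]
          sn[OF X Y f i] by simp
    qed
  qed
  then show ?thesis unfolding naturally_isomorphic_def by blast
qed

section \<open>Infinite index sets\<close>

text \<open>An Eilenberg swindle: the composite \<open>F u\<close> of the diagonal \<open>u\<close> and the codiagonal \<open>F\<close> of \<open>f\<close> is
  the sum of \<open>I\<close> copies of \<open>f\<close>. Removing one copy leaves the sum unchanged, as \<open>I\<close> is infinite,
  so \<open>F u = F u + f\<close>; and \<open>F u\<close> has the sum of copies of \<open>g\<close> as an additive inverse.\<close>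

lemma add_invertible_zero_if_infinite_biproduct:
  assumes inf: "infinite I" and X: "X \<in> Obj C"
    and S: "is_coproduct C I (\<lambda>_. X) S s" and P: "is_product C I (\<lambda>_. X) S p"
    and ps: "\<And>i j. i \<in> I \<Longrightarrow> j \<in> I \<Longrightarrow> Comp C (p j) (s i) = delta (\<lambda>_. X) j i"
    and f: "f \<in> Hom C X Y" and g: "g \<in> Hom C X Y" and fg: "Plus C f g = Neutral C X Y"
  shows "f = Neutral C X Y"
proof -
  note s = coproduct_in(2)[OF S] and p = product_in(2)[OF P] and SO = coproduct_in(1)[OF S]
  have Y: "Y \<in> Obj C" using Hom_obj(2)[OF f] .
  obtain i0 where i0: "i0 \<in> I" using inf by fastforce
  obtain \<sigma> where \<sigma>: "bij_betw \<sigma> I (I - {i0})"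
    using infinite_imp_bij_betw[OF inf, of i0] by blast
  have \<sigma>_in: "\<sigma> i \<in> I" "\<sigma> i \<noteq> i0" if "i \<in> I" for i
    using \<sigma> that by (auto simp: bij_betw_def)
  have \<sigma>_inj: "\<sigma> i = \<sigma> j \<longleftrightarrow> i = j" if "i \<in> I" "j \<in> I" for i j
    using \<sigma> that by (auto simp: bij_betw_def inj_on_def)
  obtain u where u: "u \<in> Hom C X S" and pu: "\<And>i. i \<in> I \<Longrightarrow> Comp C (p i) u = Ident C X"
    using productE[OF P X, of "\<lambda>_. Ident C X"] ident_in[OF X] by metis
  \<comment> \<open>The shift of summands along \<open>\<sigma>\<close>, whose image omits exactly the summand \<open>i0\<close>.\<close>
  obtain e where e: "e \<in> Hom C S S" and es: "\<And>i. i \<in> I \<Longrightarrow> Comp C e (s i) = s (\<sigma> i)"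
    using coproductE[OF S SO, of "\<lambda>i. s (\<sigma> i)"] s \<sigma>_in by metis
  have pe: "Comp C (p (\<sigma> j)) e = p j" if j: "j \<in> I" for j
  proof (rule coproduct_eqI[OF S comp_in[OF e p[OF \<sigma>_in(1)[OF j]]] p[OF j]])
    fix i assume i: "i \<in> I"
    show "Comp C (Comp C (p (\<sigma> j)) e) (s i) = Comp C (p j) (s i)"
      using comp_assoc[OF s[OF i] e p[OF \<sigma>_in(1)[OF j]]] es[OF i] ps[OF i j]
        ps[OF \<sigma>_in(1)[OF i] \<sigma>_in(1)[OF j]] \<sigma>_inj[OF i j]
      by (simp add: delta_def)
  qed
  have pe0: "Comp C (p i0) e = Neutral C S X"
  proof (rule coproduct_eqI[OF S comp_in[OF e p[OF i0]] neutral_in[OF SO X]])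
    fix i assume i: "i \<in> I"
    show "Comp C (Comp C (p i0) e) (s i) = Comp C (Neutral C S X) (s i)"
      using comp_assoc[OF s[OF i] e p[OF i0]] es[OF i] ps[OF \<sigma>_in(1)[OF i] i0] \<sigma>_in(2)[OF i]
        comp_neutral_left[OF s[OF i] X]
      by (simp add: delta_def)
  qed
  note eu = comp_in[OF u e]
  \<comment> \<open>The shifted diagonal has components identity except at \<open>i0\<close>, which the summand \<open>s i0\<close> supplies.\<close>
  have u_eq: "u = Plus C (Comp C e u) (s i0)"
  proof (rule product_eqI[OF P u plus_in[OF eu s[OF i0]]])
    fix j assume j: "j \<in> I"
    have *: "Comp C (p j) (Plus C (Comp C e u) (s i0)) =
        Plus C (Comp C (Comp C (p j) e) u) (delta (\<lambda>_. X) j i0)"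
      using comp_plus_right[OF eu s[OF i0] p[OF j]] comp_assoc[OF u e p[OF j]] ps[OF i0 j] by simp
    have "Plus C (Comp C (Comp C (p j) e) u) (delta (\<lambda>_. X) j i0) = Ident C X"
    proof (cases "j = i0")
      case True
      then show ?thesis
        using pe0 comp_neutral_left[OF u X] plus_neutral(1)[OF ident_in[OF X]]
        by (simp add: delta_def)
    next
      case False
      then obtain i where "i \<in> I" "j = \<sigma> i" using \<sigma> j by (auto simp: bij_betw_def)
      then show ?thesis
        using False pe pu plus_neutral(2)[OF ident_in[OF X]] by (simp add: delta_def)
    qed
    then show "Comp C (p j) u = Comp C (p j) (Plus C (Comp C e u) (s i0))"
      using * pu[OF j] by simp
  qed
  obtain F where F: "F \<in> Hom C S Y" and Fs: "\<And>i. i \<in> I \<Longrightarrow> Comp C F (s i) = f"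
    using coproductE[OF S Y, of "\<lambda>_. f"] f by metis
  obtain G where G: "G \<in> Hom C S Y" and Gs: "\<And>i. i \<in> I \<Longrightarrow> Comp C G (s i) = g"
    using coproductE[OF S Y, of "\<lambda>_. g"] g by metis
  \<comment> \<open>All entries of the codiagonal are equal, so it is invariant under the shift.\<close>
  have Fe: "Comp C F e = F"
  proof (rule coproduct_eqI[OF S comp_in[OF e F] F])
    fix i assume i: "i \<in> I"
    show "Comp C (Comp C F e) (s i) = Comp C F (s i)"
      using comp_assoc[OF s[OF i] e F] es[OF i] Fs[OF i] Fs[OF \<sigma>_in(1)[OF i]] by simp
  qed
  have FG: "Plus C F G = Neutral C S Y"
  proof (rule coproduct_eqI[OF S plus_in[OF F G] neutral_in[OF SO Y]])
    fix i assume i: "i \<in> I"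
    show "Comp C (Plus C F G) (s i) = Comp C (Neutral C S Y) (s i)"
      using comp_plus_left[OF s[OF i] F G] Fs[OF i] Gs[OF i] fg comp_neutral_left[OF s[OF i] Y]
      by simp
  qed
  let ?a = "Comp C F u" and ?b = "Comp C G u"
  note a = comp_in[OF u F] and b = comp_in[OF u G]
  have "?a = Comp C F (Plus C (Comp C e u) (s i0))" using u_eq by simp
  also have "\<dots> = Plus C ?a f"
    using comp_plus_right[OF eu s[OF i0] F] comp_assoc[OF u e F] Fe Fs[OF i0] by simp
  finally have absorb: "?a = Plus C ?a f" .
  have inv: "Plus C ?a ?b = Neutral C X Y"
    using comp_plus_left[OF u F G] FG comp_neutral_left[OF u Y] by simp
  have "f = Plus C f (Plus C ?a ?b)" using inv plus_neutral(2)[OF f] by simp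
  also have "\<dots> = Plus C (Plus C ?a f) ?b"
    using plus_assoc[OF f a b] plus_comm[OF f a] by simp
  also have "\<dots> = Neutral C X Y" using absorb inv by simp
  finally show ?thesis .
qed

text \<open>The composites \<open>s i \<circ> q i\<close> and \<open>j i \<circ> p i\<close> are idempotents of \<open>S\<close> and \<open>P\<close> that split through the
  \<open>i\<close>-th component. An isomorphism \<open>t\<close> that commutes with them satisfies
  \<open>t \<circ> s i = j i \<circ> \<theta> i\<close>, where \<open>\<theta> i\<close> is its diagonal entry: its matrix is diagonal. The inverse
  of \<open>t\<close> commutes with the idempotents too, so its diagonal entry \<open>\<theta>' i\<close> is inverse to
  \<open>\<theta> i\<close>. The projections of \<open>S\<close> are those transported from \<open>P\<close> along \<open>t\<close>, corrected by
  \<open>\<theta>' i\<close> to make the matrix the identity.\<close>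

lemma coproduct_is_product_if_iso:
  assumes X: "X \<in> Obj C"
    and S: "is_coproduct C I (\<lambda>_. X) S s" and P: "is_product C I (\<lambda>_. X) P p"
    and iso: "iso_arr C S P t"
    and q: "\<And>i. i \<in> I \<Longrightarrow> q i \<in> Hom C S X" and j: "\<And>i. i \<in> I \<Longrightarrow> j i \<in> Hom C X P"
    and qs: "\<And>i. i \<in> I \<Longrightarrow> Comp C (q i) (s i) = Ident C X"
    and pj: "\<And>i k. i \<in> I \<Longrightarrow> k \<in> I \<Longrightarrow> Comp C (p k) (j i) = delta (\<lambda>_. X) k i"
    and comm: "\<And>i. i \<in> I \<Longrightarrow> Comp C t (Comp C (s i) (q i)) = Comp C (Comp C (j i) (p i)) t"
  shows "\<exists>r. is_product C I (\<lambda>_. X) S r \<and>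
    (\<forall>i\<in>I. \<forall>k\<in>I. Comp C (r k) (s i) = delta (\<lambda>_. X) k i)"
proof -
  note s = coproduct_in(2)[OF S] and p = product_in(2)[OF P] and SO = coproduct_in(1)[OF S]
  note PO = product_in(1)[OF P]
  from iso obtain t' where t: "t \<in> Hom C S P" and t': "t' \<in> Hom C P S"
    and t't: "Comp C t' t = Ident C S" and tt': "Comp C t t' = Ident C P"
    unfolding iso_arr_def by blast
  define \<theta> where "\<theta> i = Comp C (p i) (Comp C t (s i))" for i
  define \<theta>' where "\<theta>' i = Comp C (q i) (Comp C t' (j i))" for i
  have \<theta>: "\<theta> i \<in> Hom C X X" and \<theta>': "\<theta>' i \<in> Hom C X X" if "i \<in> I" for i
    unfolding \<theta>_def \<theta>'_def
    using comp_in[OF comp_in[OF s[OF that] t] p[OF that]]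
      comp_in[OF comp_in[OF j[OF that] t'] q[OF that]] .
  have ts: "Comp C t (s i) = Comp C (j i) (\<theta> i)" if i: "i \<in> I" for i
  proof -
    have "Comp C t (s i) = Comp C (Comp C t (Comp C (s i) (q i))) (s i)"
      using comp_assoc[OF s[OF i] comp_in[OF q[OF i] s[OF i]] t]
        comp_assoc[OF s[OF i] q[OF i] s[OF i]] qs[OF i] comp_ident_right[OF s[OF i]] by simp
    also have "\<dots> = Comp C (j i) (\<theta> i)"
      using comm[OF i] comp_assoc[OF s[OF i] t comp_in[OF p[OF i] j[OF i]]]
        comp_assoc[OF comp_in[OF s[OF i] t] p[OF i] j[OF i]] by (simp add: \<theta>_def)
    finally show ?thesis .
  qed
  have \<theta>'\<theta>: "Comp C (\<theta>' i) (\<theta> i) = Ident C X" if i: "i \<in> I" for i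
  proof -
    have "Comp C (\<theta>' i) (\<theta> i) = Comp C (q i) (Comp C t' (Comp C t (s i)))"
      using comp_assoc[OF \<theta>[OF i] comp_in[OF j[OF i] t'] q[OF i]] comp_assoc[OF \<theta>[OF i] j[OF i] t']
        ts[OF i] by (simp add: \<theta>'_def)
    also have "\<dots> = Ident C X"
      using comp_assoc[OF s[OF i] t t'] t't comp_ident_left[OF s[OF i]] qs[OF i] by simp
    finally show ?thesis .
  qed
  have \<theta>\<theta>': "Comp C (\<theta> i) (\<theta>' i) = Ident C X" if i: "i \<in> I" for i
  proof -
    let ?b = "Comp C t' (j i)"
    note b = comp_in[OF j[OF i] t']
    have "Comp C (\<theta> i) (\<theta>' i) = Comp C (p i) (Comp C (Comp C t (s i)) (\<theta>' i))"
      using comp_assoc[OF \<theta>'[OF i] comp_in[OF s[OF i] t] p[OF i]] by (simp add: \<theta>_def)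
    also have "Comp C (Comp C t (s i)) (\<theta>' i) = Comp C (Comp C t (Comp C (s i) (q i))) ?b"
      using comp_assoc[OF \<theta>'[OF i] s[OF i] t] comp_assoc[OF b q[OF i] s[OF i]]
        comp_assoc[OF b comp_in[OF q[OF i] s[OF i]] t] by (simp add: \<theta>'_def)
    also have "\<dots> = Comp C (Comp C (j i) (p i)) (Comp C t ?b)"
      using comm[OF i] comp_assoc[OF b t comp_in[OF p[OF i] j[OF i]]] by simp
    also have "Comp C t ?b = j i"
      using comp_assoc[OF j[OF i] t' t] tt' comp_ident_left[OF j[OF i]] by simp
    also have "Comp C (Comp C (j i) (p i)) (j i) = j i"
      using comp_assoc[OF j[OF i] p[OF i] j[OF i]] pj[OF i i] comp_ident_right[OF j[OF i]]
      by (simp add: delta_def)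
    finally show ?thesis using pj[OF i i] by (simp add: delta_def)
  qed
  define r where "r i = Comp C (\<theta>' i) (Comp C (p i) t)" for i
  have r: "r i \<in> Hom C S X" if "i \<in> I" for i
    unfolding r_def using comp_in[OF comp_in[OF t p[OF that]] \<theta>'[OF that]] .
  have r_comp: "Comp C (r i) h = Comp C (\<theta>' i) (Comp C (p i) (Comp C t h))"
    if "i \<in> I" "h \<in> Hom C Q S" for i h Q
    unfolding r_def
    using comp_assoc[OF that(2) comp_in[OF t p[OF that(1)]] \<theta>'[OF that(1)]]
      comp_assoc[OF that(2) t p[OF that(1)]] by simp
  have "is_product C I (\<lambda>_. X) S r"
    unfolding is_product_def
  proof (intro conjI ballI allI impI SO r)
    fix Q a assume Q: "Q \<in> Obj C" and a: "\<forall>i\<in>I. a i \<in> Hom C Q X"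
    \<comment> \<open>The components are multiplied by \<open>\<theta> i\<close> in advance because \<open>r i\<close> multiplies by \<open>\<theta>' i\<close>.\<close>
    obtain h where h: "h \<in> Hom C Q P" and ph: "\<And>i. i \<in> I \<Longrightarrow> Comp C (p i) h = Comp C (\<theta> i) (a i)"
      using productE[OF P Q, of "\<lambda>i. Comp C (\<theta> i) (a i)"] comp_in[OF _ \<theta>] a by metis
    note t'h = comp_in[OF h t']
    show "\<exists>!h. h \<in> Hom C Q S \<and> (\<forall>i\<in>I. Comp C (r i) h = a i)"
    proof (rule ex1I[of _ "Comp C t' h"], intro conjI t'h ballI)
      fix i assume i: "i \<in> I"
      have ai: "a i \<in> Hom C Q X" using a i by blast
      show "Comp C (r i) (Comp C t' h) = a i"
        using r_comp[OF i t'h] comp_assoc[OF h t' t] tt' comp_ident_left[OF h] ph[OF i]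
          comp_assoc[OF ai \<theta>[OF i] \<theta>'[OF i]] \<theta>'\<theta>[OF i] comp_ident_left[OF ai] by simp
    next
      fix k assume k: "k \<in> Hom C Q S \<and> (\<forall>i\<in>I. Comp C (r i) k = a i)"
      then have k1: "k \<in> Hom C Q S" by simp
      have "Comp C t k = h"
      proof (rule product_eqI[OF P comp_in[OF k1 t] h])
        fix i assume i: "i \<in> I"
        note c = comp_in[OF comp_in[OF k1 t] p[OF i]]
        have "Comp C (p i) (Comp C t k) = Comp C (\<theta> i) (Comp C (r i) k)"
          using r_comp[OF i k1] comp_assoc[OF c \<theta>'[OF i] \<theta>[OF i]] \<theta>\<theta>'[OF i] comp_ident_left[OF c]
          by simp
        then show "Comp C (p i) (Comp C t k) = Comp C (p i) h" using k i ph[OF i] by simp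
      qed
      then show "k = Comp C t' h"
        using comp_assoc[OF k1 t t'] t't comp_ident_left[OF k1] by simp
    qed
  qed
  moreover have "Comp C (r k) (s i) = delta (\<lambda>_. X) k i" if i: "i \<in> I" and k: "k \<in> I" for i k
  proof -
    have "Comp C (r k) (s i) = Comp C (\<theta>' k) (Comp C (delta (\<lambda>_. X) k i) (\<theta> i))"
      using r_comp[OF k s[OF i]] ts[OF i] comp_assoc[OF \<theta>[OF i] j[OF i] p[OF k]] pj[OF i k] by simp
    then show ?thesis
      using comp_ident_left[OF \<theta>[OF i]] \<theta>'\<theta>[OF i] comp_neutral_left[OF \<theta>[OF i] X]
        comp_neutral_right[OF \<theta>'[OF k] X]
      by (auto simp: delta_def)
  qed
  ultimately show ?thesis by blast
qed

text \<open>Naturality is applied to the endomorphisms \<open>e i\<close> of the constant family \<open>A\<close> that are the identity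
  at \<open>i\<close> and neutral elsewhere. The two functors send \<open>e i\<close> to the idempotents that project to
  the \<open>i\<close>-th component, so the isomorphism commutes with these and the coproduct of copies of \<open>A\<close>
  is also their product.\<close>

lemma add_invertible_zero_if_naturally_isomorphic_infinite:
  assumes inf: "infinite I"
    and SF: "is_coproduct_functor C I S" and PF: "is_product_functor C I P"
    and iso: "naturally_isomorphic (power_cat C I) C S P"
    and f: "f \<in> Hom C A B" and g: "g \<in> Hom C A B" and fg: "Plus C f g = Neutral C A B"
  shows "f = Neutral C A B"
proof -
  let ?D = "power_cat C I" and ?X = "\<lambda>i\<in>I. A"
  have A: "A \<in> Obj C" using Hom_obj(1)[OF f] .
  obtain s where s: "\<And>X. X \<in> Obj ?D \<Longrightarrow> is_coproduct C I X (FObj S X) (s X)"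
    and sn: "\<And>X Y f i. \<lbrakk>X \<in> Obj ?D; Y \<in> Obj ?D; f \<in> Hom ?D X Y; i \<in> I\<rbrakk> \<Longrightarrow>
       Comp C (FArr S f) (s X i) = Comp C (s Y i) (f i)"
    using coproduct_functor_injections[OF SF] by metis
  obtain p where p: "\<And>X. X \<in> Obj ?D \<Longrightarrow> is_product C I X (FObj P X) (p X)"
    and pn: "\<And>X Y f i. \<lbrakk>X \<in> Obj ?D; Y \<in> Obj ?D; f \<in> Hom ?D X Y; i \<in> I\<rbrakk> \<Longrightarrow>
       Comp C (p Y i) (FArr P f) = Comp C (f i) (p X i)"
    using product_functor_projections[OF PF] by metis
  obtain t where t: "natural_iso ?D C S P t" using iso by (auto simp: naturally_isomorphic_def)
  have X: "?X \<in> Obj ?D" using A by (simp add: Obj_power_cat)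
  let ?S = "FObj S ?X" and ?P = "FObj P ?X" and ?s = "s ?X" and ?p = "p ?X"
  have cS: "is_coproduct C I (\<lambda>_. A) ?S ?s" using s[OF X] by (simp add: is_coproduct_def)
  have pP: "is_product C I (\<lambda>_. A) ?P ?p" using p[OF X] by (simp add: is_product_def)
  let ?d = "delta (\<lambda>_. A)"
  have d: "?d k i \<in> Hom C A A" for k i using delta_in[of "\<lambda>_. A"] A by simp
  define e where "e i = (\<lambda>k\<in>I. ?d k i)" for i
  have e: "e i \<in> Hom ?D ?X ?X" for i
    using d by (auto simp: e_def Hom_power_cat[OF X X])
  have "\<exists>q. q \<in> Hom C ?S A \<and> (\<forall>k\<in>I. Comp C q (?s k) = ?d i k)" for i
    using coproductE[OF cS A, of "\<lambda>k. ?d i k"] d by metis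
  then obtain q where q: "\<And>i. q i \<in> Hom C ?S A"
    and qs: "\<And>i k. k \<in> I \<Longrightarrow> Comp C (q i) (?s k) = ?d i k"
    by metis
  have "\<exists>j. j \<in> Hom C A ?P \<and> (\<forall>k\<in>I. Comp C (?p k) j = ?d k i)" for i
    using productE[OF pP A, of "\<lambda>k. ?d k i"] d by metis
  then obtain j where j: "\<And>i. j i \<in> Hom C A ?P"
    and pj: "\<And>i k. k \<in> I \<Longrightarrow> Comp C (?p k) (j i) = ?d k i"
    by metis
  note sX = coproduct_in(2)[OF cS] and pX = product_in(2)[OF pP]
  have SA: "FArr S (e i) \<in> Hom C ?S ?S" and PA: "FArr P (e i) \<in> Hom C ?P ?P" for i
    using functor_arr[OF coproduct_functor_is_functor[OF SF] X X e]
      functor_arr[OF product_functor_is_functor[OF PF] X X e] .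
  have Se: "FArr S (e i) = Comp C (?s i) (q i)" if i: "i \<in> I" for i
  proof (rule coproduct_eqI[OF cS SA comp_in[OF q sX[OF i]]])
    fix k assume k: "k \<in> I"
    have "Comp C (FArr S (e i)) (?s k) = Comp C (?s k) (?d k i)"
      using sn[OF X X e k] k by (simp add: e_def)
    also have "\<dots> = Comp C (?s i) (?d i k)"
      using comp_neutral_right[OF sX[OF i] A] comp_neutral_right[OF sX[OF k] A]
      by (auto simp: delta_def)
    finally show "Comp C (FArr S (e i)) (?s k) = Comp C (Comp C (?s i) (q i)) (?s k)"
      using comp_assoc[OF sX[OF k] q sX[OF i]] qs[OF k] by simp
  qed
  have Pe: "FArr P (e i) = Comp C (j i) (?p i)" if i: "i \<in> I" for i
  proof (rule product_eqI[OF pP PA comp_in[OF pX[OF i] j]])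
    fix k assume k: "k \<in> I"
    have "Comp C (?p k) (FArr P (e i)) = Comp C (?d k i) (?p k)"
      using pn[OF X X e k] k by (simp add: e_def)
    also have "\<dots> = Comp C (?d k i) (?p i)"
      using comp_neutral_left[OF pX[OF i] A] comp_neutral_left[OF pX[OF k] A]
      by (auto simp: delta_def)
    finally show "Comp C (?p k) (FArr P (e i)) = Comp C (?p k) (Comp C (j i) (?p i))"
      using comp_assoc[OF pX[OF i] j pX[OF k]] pj[OF k] by simp
  qed
  have ti: "iso_arr C ?S ?P (t ?X)" using t X by (simp add: natural_iso_def)
  have "Comp C (t ?X) (Comp C (?s i) (q i)) = Comp C (Comp C (j i) (?p i)) (t ?X)" if "i \<in> I" for i
    using t X e[of i] Se[OF that] Pe[OF that] unfolding natural_iso_def by metis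
  then obtain r where "is_product C I (\<lambda>_. A) ?S r"
    "\<forall>i\<in>I. \<forall>k\<in>I. Comp C (r k) (?s i) = ?d k i"
    using coproduct_is_product_if_iso[OF A cS pP ti, of q j] q j qs pj
    by (auto simp: delta_def)
  then show ?thesis
    using add_invertible_zero_if_infinite_biproduct[OF inf A cS _ _ f g fg] by blast
qed

end

theorem theorem1p4:
  fixes C :: "('o, 'a) amon_cat"
    and I :: "'i set"
    and CoprodF ProdF :: "('i \<Rightarrow> 'o, 'i \<Rightarrow> 'a, 'o, 'a) fctr"
  assumes "amon_category C"
    and "\<exists>Z. zero_object C Z"
    and "has_products C I"
    and "has_coproducts C I"
    and "\<exists>X \<in> Obj C. \<exists>Y \<in> Obj C. \<exists>f \<in> Hom C X Y. f \<noteq> zero_mor C X Y \<and> add_invertible C X Y f"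
    and "is_coproduct_functor C I CoprodF"
    and "is_product_functor C I ProdF"
  shows "naturally_isomorphic (power_cat C I) C CoprodF ProdF \<longleftrightarrow> finite I"
proof -
  interpret amon_category C by (rule assms(1))
  obtain Z where Z: "zero_object C Z" using assms(2) by blast
  obtain X Y f g where X: "X \<in> Obj C" and Y: "Y \<in> Obj C"
    and f: "f \<in> Hom C X Y" "f \<noteq> zero_mor C X Y" and g: "g \<in> Hom C X Y" "Plus C f g = zero_mor C X Y"
    using assms(5) unfolding add_invertible_def by blast
  note zero = zero_mor_eq_neutral[OF Z X Y]
  show ?thesis
    using naturally_isomorphic_finite[OF _ assms(6,7)] zero f g
      add_invertible_zero_if_naturally_isomorphic_infinite[OF _ assms(6,7) _ f(1) g(1)] by metis
qed

end
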